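(* Let $B_1\subset\mathbb{R}^2$ be the open unit disc, let $u\in C^{1,1}(B_1)$ be nonnegative, let $\Omega:=\{u>0\}\cap B_1$, and assume $u\in C^2(\overline\Omega)$ and \[ \Delta u=1\ \text{ in }\Omega,\qquad u=0=|\nabla u|\ \text{ on }\partial\Omega\cap B_1. \] Then the set of branching points \[ \mathcal B(u):=\Big\{x\in\partial\Omega\cap B_1:\ \lim_{r\to0}\frac{|B_r(x)\cap\Omega|}{|B_r(x)|}=1\Big\}\cap\overline{\mathrm{int}(\{u=0\})} \] is locally finite in $B_1$, i.e. every compact subset of $B_1$ contains only finitely many points of $\mathcal B(u)$.
   Context: $|E|$ denotes Lebesgue measure and $\mathrm{int}(\{u=0\})$ the interior of the zero set of $u$. *)

theory Defs
  imports "HOL-Analysis.Analysis"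
begin

definition B1 :: "(real^2) set" where
  "B1 = ball 0 1"

definition pos_set :: "(real^2 \<Rightarrow> real) \<Rightarrow> (real^2) set" where
  "pos_set u = {x \<in> B1. u x > 0}"

definition branching_points :: "(real^2 \<Rightarrow> real) \<Rightarrow> (real^2) set" where
  "branching_points u =
     {x \<in> frontier (pos_set u) \<inter> B1.
        ((\<lambda>r. measure lebesgue (ball x r \<inter> pos_set u) / measure lebesgue (ball x r))
           \<longlongrightarrow> 1) (at_right 0)}
     \<inter> closure (interior {y \<in> B1. u y = 0})"

end

theory Submission
  imports Defs "HOL-Complex_Analysis.Complex_Analysis"
begin

text \<open>
  Near a limit point \<open>x0\<close> of branching points write the gradient of \<open>u\<close> as a complex function \<open>c\<close>. It
  vanishes off \<open>\<Omega>\<close>, and \<open>\<Delta>u = 1\<close> says that \<open>\<Psi> z = Re z - cnj (c z)\<close> is holomorphic on \<open>\<Omega>\<close>.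
  Rotate so that the eigenvector of the larger eigenvalue of the Hessian at \<open>x0\<close> is vertical. By
  continuity of the Hessian, \<open>Im c\<close> strictly increases on \<open>\<Omega>\<close> in all directions close to the
  vertical. Hence \<open>{Im c > 0}\<close> and \<open>{Im c < 0}\<close> are stable under an upward, respectively downward,
  cone, \<open>c\<close> is almost linear on each of them, and the zero set meets every vertical line in an
  interval. As \<open>c = 0\<close> along the upper boundary of the interior of the zero set, the Hessian at \<open>x0\<close>
  has eigenvalues 0 and 1; thus \<open>\<Psi>\<close> is close to the identity and maps the two sides bijectively
  to the upper and lower half disc, with inverses \<open>G\<close> and \<open>G\<^sub>-\<close> that are continuous up to the real
  axis.

  At a real point \<open>t\<close> either \<open>G t = G\<^sub>- t\<close>, or both lie in the zero set and have real part \<open>t\<close>. So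
  \<open>D w = G w + cnj (G\<^sub>- (cnj w)) - 2 w\<close> is real or purely imaginary on the axis, and \<open>D\<^sup>2\<close> extends
  holomorphically by Schwarz reflection. Density one forces the vertical line through a branching
  point to meet the zero set only there, so \<open>D\<close> vanishes at its real part. These real parts
  accumulate, whence \<open>D = 0\<close>; but \<open>D\<close> does not vanish at the real part of an interior point of the
  zero set.
\<close>

lemma second_derivative_symmetric:
  fixes u :: "'a::real_inner \<Rightarrow> real" and g :: "'a \<Rightarrow> 'a"
  assumes S: "open S" "x \<in> S" and u: "\<And>y. y \<in> S \<Longrightarrow> (u has_derivative (\<lambda>h. g y \<bullet> h)) (at y)"
    and g: "(g has_derivative A) (at x)"
  shows "a \<bullet> A b = b \<bullet> A a"
proof -
  interpret A: bounded_linear A using g by (rule has_derivative_bounded_linear)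
  have est: "\<exists>d>0. \<forall>t. 0 < t \<longrightarrow> t < d \<longrightarrow>
      \<bar>u (x + t *\<^sub>R a + t *\<^sub>R b) - u (x + t *\<^sub>R a) - u (x + t *\<^sub>R b) + u x - t\<^sup>2 * (a \<bullet> A b)\<bar>
        \<le> e * t\<^sup>2" if e: "0 < e" for a b e
  proof -
    define M where "M = norm a + norm b + 1"
    have M: "0 < M" "norm a \<le> M" by (auto simp: M_def intro: add_nonneg_pos)
    define \<eta> where "\<eta> = e / (2 * M\<^sup>2)"
    have \<eta>: "0 < \<eta>" using e M by (simp add: \<eta>_def)
    obtain d1 where d1: "0 < d1" "\<And>y. norm (y - x) < d1 \<Longrightarrow> norm (g y - g x - A (y - x)) \<le> \<eta> * norm (y - x)"
      using g \<eta> unfolding has_derivative_at_alt by blast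
    obtain d2 where d2: "0 < d2" "ball x d2 \<subseteq> S" using S openE by blast
    define d where "d = min d1 d2 / M"
    have d: "0 < d" using d1 d2 M by (simp add: d_def)
    have "\<bar>u (x + t *\<^sub>R a + t *\<^sub>R b) - u (x + t *\<^sub>R a) - u (x + t *\<^sub>R b) + u x - t\<^sup>2 * (a \<bullet> A b)\<bar> \<le> e * t\<^sup>2"
      if t: "0 < t" "t < d" for t
    proof -
      have tM: "t * M < min d1 d2" using t M by (simp add: d_def field_simps)
      have small: "norm (s *\<^sub>R a + r *\<^sub>R b) \<le> t * M" if "0 \<le> s" "s \<le> t" "0 \<le> r" "r \<le> t" for s r
      proof -
        have "norm (s *\<^sub>R a + r *\<^sub>R b) \<le> s * norm a + r * norm b"
          using norm_triangle_ineq[of "s *\<^sub>R a" "r *\<^sub>R b"] that by simp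
        also have "\<dots> \<le> t * norm a + t * norm b"
          using that by (intro add_mono mult_right_mono) auto
        also have "\<dots> \<le> t * M" using t by (simp add: M_def algebra_simps)
        finally show ?thesis .
      qed
      have inS: "x + s *\<^sub>R a + r *\<^sub>R b \<in> S" if "0 \<le> s" "s \<le> t" "0 \<le> r" "r \<le> t" for s r
      proof -
        have "norm (s *\<^sub>R a + r *\<^sub>R b) < d2" using small[OF that] tM by simp
        then have "dist (x + (s *\<^sub>R a + r *\<^sub>R b)) x < d2" by (simp add: dist_norm)
        then have "x + s *\<^sub>R a + r *\<^sub>R b \<in> ball x d2" by (simp add: dist_commute add.assoc)
        then show ?thesis using d2 by blast
      qed
      have gd: "norm (g (x + s *\<^sub>R a + r *\<^sub>R b) - g x - A (s *\<^sub>R a + r *\<^sub>R b)) \<le> \<eta> * (t * M)"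
        if "0 \<le> s" "s \<le> t" "0 \<le> r" "r \<le> t" for s r
      proof -
        have e: "x + s *\<^sub>R a + r *\<^sub>R b - x = s *\<^sub>R a + r *\<^sub>R b" by simp
        have "norm (g (x + s *\<^sub>R a + r *\<^sub>R b) - g x - A (s *\<^sub>R a + r *\<^sub>R b)) \<le> \<eta> * norm (s *\<^sub>R a + r *\<^sub>R b)"
          using d1(2)[of "x + s *\<^sub>R a + r *\<^sub>R b"] small[OF that] tM unfolding e by simp
        also have "\<dots> \<le> \<eta> * (t * M)" using small[OF that] \<eta> by (intro mult_left_mono) auto
        finally show ?thesis .
      qed
      define f where "f s = u (x + s *\<^sub>R a + t *\<^sub>R b) - u (x + s *\<^sub>R a + 0 *\<^sub>R b)" for s
      have ud: "((\<lambda>s. u (x + s *\<^sub>R a + r *\<^sub>R b)) has_derivative (\<lambda>h. g (x + s *\<^sub>R a + r *\<^sub>R b) \<bullet> (h *\<^sub>R a))) (at s)"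
        if "0 \<le> s" "s \<le> t" "0 \<le> r" "r \<le> t" for s r
      proof -
        have l: "((\<lambda>s. x + s *\<^sub>R a + r *\<^sub>R b) has_derivative (\<lambda>h. h *\<^sub>R a)) (at s)"
          by (auto intro!: derivative_eq_intros)
        show ?thesis by (rule has_derivative_compose[OF l u[OF inS[OF that]]])
      qed
      have fd: "(f has_derivative (\<lambda>h. g (x + s *\<^sub>R a + t *\<^sub>R b) \<bullet> (h *\<^sub>R a) - g (x + s *\<^sub>R a + 0 *\<^sub>R b) \<bullet> (h *\<^sub>R a))) (at s)"
        if "0 \<le> s" "s \<le> t" for s
        unfolding f_def using that t by (intro has_derivative_diff ud) auto
      obtain s where s: "0 < s" "s < t" "f t - f 0 = g (x + s *\<^sub>R a + t *\<^sub>R b) \<bullet> ((t - 0) *\<^sub>R a) - g (x + s *\<^sub>R a + 0 *\<^sub>R b) \<bullet> ((t - 0) *\<^sub>R a)"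
        using mvt_simple[OF t(1) has_derivative_at_withinI[OF fd]] by auto
      define p where "p = g (x + s *\<^sub>R a + t *\<^sub>R b) - g x - A (s *\<^sub>R a + t *\<^sub>R b)"
      define q where "q = g (x + s *\<^sub>R a + 0 *\<^sub>R b) - g x - A (s *\<^sub>R a + 0 *\<^sub>R b)"
      have pq: "norm p \<le> \<eta> * (t * M)" "norm q \<le> \<eta> * (t * M)"
        unfolding p_def q_def by (rule gd; use s t in simp)+
      have "f t - f 0 = t * (a \<bullet> (p - q)) + t\<^sup>2 * (a \<bullet> A b)"
        unfolding s(3) p_def q_def
        by (simp add: A.add A.scaleR inner_diff_right inner_add_right algebra_simps power2_eq_square inner_commute)
      moreover have "\<bar>t * (a \<bullet> (p - q))\<bar> \<le> e * t\<^sup>2"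
      proof -
        have "norm (p - q) \<le> 2 * (\<eta> * (t * M))" using pq norm_triangle_ineq4[of p q] by linarith
        then have "\<bar>a \<bullet> (p - q)\<bar> \<le> M * (2 * (\<eta> * (t * M)))"
          using Cauchy_Schwarz_ineq2[of a "p - q"] M by (meson mult_mono norm_ge_zero order_trans less_imp_le)
        then have "t * \<bar>a \<bullet> (p - q)\<bar> \<le> t * (M * (2 * (\<eta> * (t * M))))"
          using t by (intro mult_left_mono) auto
        also have "\<dots> = (2 * M\<^sup>2 * \<eta>) * t\<^sup>2" by (simp add: power2_eq_square)
        also have "2 * M\<^sup>2 * \<eta> = e" using M by (simp add: \<eta>_def)
        finally show ?thesis using t by (simp add: abs_mult)
      qed
      moreover have "f t - f 0 = u (x + t *\<^sub>R a + t *\<^sub>R b) - u (x + t *\<^sub>R a) - u (x + t *\<^sub>R b) + u x"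
        by (simp add: f_def)
      ultimately show ?thesis by simp
    qed
    with d show ?thesis by blast
  qed
  show ?thesis
  proof (rule ccontr)
    assume ne: "a \<bullet> A b \<noteq> b \<bullet> A a"
    define e where "e = \<bar>a \<bullet> A b - b \<bullet> A a\<bar> / 4"
    have e: "0 < e" using ne by (simp add: e_def)
    obtain d1 where d1: "0 < d1" "\<And>t. 0 < t \<Longrightarrow> t < d1 \<Longrightarrow>
      \<bar>u (x + t *\<^sub>R a + t *\<^sub>R b) - u (x + t *\<^sub>R a) - u (x + t *\<^sub>R b) + u x - t\<^sup>2 * (a \<bullet> A b)\<bar> \<le> e * t\<^sup>2"
      using est[OF e, of a b] by blast
    obtain d2 where d2: "0 < d2" "\<And>t. 0 < t \<Longrightarrow> t < d2 \<Longrightarrow>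
      \<bar>u (x + t *\<^sub>R b + t *\<^sub>R a) - u (x + t *\<^sub>R b) - u (x + t *\<^sub>R a) + u x - t\<^sup>2 * (b \<bullet> A a)\<bar> \<le> e * t\<^sup>2"
      using est[OF e, of b a] by blast
    define t where "t = min d1 d2 / 2"
    have t: "0 < t" "t < d1" "t < d2" using d1(1) d2(1) by (auto simp: t_def)
    have c: "x + t *\<^sub>R b + t *\<^sub>R a = x + t *\<^sub>R a + t *\<^sub>R b" by simp
    have "\<bar>t\<^sup>2 * (a \<bullet> A b) - t\<^sup>2 * (b \<bullet> A a)\<bar> \<le> 2 * (e * t\<^sup>2)"
      using d1(2)[OF t(1,2)] d2(2)[OF t(1,3)] unfolding c by linarith
    moreover have "\<bar>t\<^sup>2 * (a \<bullet> A b) - t\<^sup>2 * (b \<bullet> A a)\<bar> = 4 * (e * t\<^sup>2)"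
      by (simp add: e_def abs_mult flip: right_diff_distrib)
    moreover have "0 < e * t\<^sup>2" using e t by simp
    ultimately show False by linarith
  qed
qed

lemma not_density_one:
  fixes p :: "real^2"
  assumes S: "open S" and \<theta>: "0 < \<theta>" "\<theta> < 1/2" and r0: "0 < r0"
    and hole: "\<And>r. 0 < r \<Longrightarrow> r < r0 \<Longrightarrow> \<exists>y. dist y p \<le> r/2 \<and> ball y (\<theta> * r) \<inter> S = {}"
  shows "\<not> ((\<lambda>r. measure lebesgue (ball p r \<inter> S) / measure lebesgue (ball p r)) \<longlongrightarrow> 1) (at_right 0)"
proof
  assume lim: "((\<lambda>r. measure lebesgue (ball p r \<inter> S) / measure lebesgue (ball p r)) \<longlongrightarrow> 1) (at_right 0)"
  have vol: "measure lebesgue (ball q r) = pi * r\<^sup>2" if "0 \<le> r" for q :: "real^2" and r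
    using that by (simp add: content_ball unit_ball_vol_2)
  have "measure lebesgue (ball p r \<inter> S) / measure lebesgue (ball p r) \<le> 1 - \<theta>\<^sup>2"
    if r: "0 < r" "r < r0" for r
  proof -
    obtain y where y: "dist y p \<le> r/2" "ball y (\<theta> * r) \<inter> S = {}" using hole[OF r] by blast
    have \<theta>r: "\<theta> * r < r/2" using \<theta> r by simp
    have sub: "ball p r \<inter> S \<union> ball y (\<theta> * r) \<subseteq> ball p r"
    proof -
      have "ball y (\<theta> * r) \<subseteq> ball p r"
      proof
        fix w assume "w \<in> ball y (\<theta> * r)"
        then have "dist y w < r/2" using \<theta>r by simp
        then show "w \<in> ball p r" using y(1) dist_triangle[of p w y] by (simp add: dist_commute)
      qed
      then show ?thesis by blast
    qed
    have m: "ball p r \<inter> S \<in> lmeasurable"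
      using S by (intro lmeasurable_open bounded_Int) auto
    have "measure lebesgue (ball p r \<inter> S) + measure lebesgue (ball y (\<theta> * r))
        = measure lebesgue (ball p r \<inter> S \<union> ball y (\<theta> * r))"
    proof -
      have "ball p r \<inter> S \<inter> ball y (\<theta> * r) = {}" using y(2) by blast
      then show ?thesis using m by (simp add: measure_Un3)
    qed
    also have "\<dots> \<le> measure lebesgue (ball p r)"
      using sub m by (intro measure_mono_fmeasurable) auto
    finally have "measure lebesgue (ball p r \<inter> S) + pi * (\<theta> * r)\<^sup>2 \<le> pi * r\<^sup>2"
      using \<theta> r by (simp only: vol less_imp_le mult_nonneg_nonneg)
    then have "measure lebesgue (ball p r \<inter> S) \<le> (1 - \<theta>\<^sup>2) * (pi * r\<^sup>2)"
      by (simp add: power_mult_distrib algebra_simps)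
    moreover have "0 < pi * r\<^sup>2" using r by simp
    ultimately show ?thesis using r by (simp only: vol less_imp_le pos_divide_le_eq)
  qed
  then have "\<forall>\<^sub>F r in at_right 0. measure lebesgue (ball p r \<inter> S) / measure lebesgue (ball p r) \<le> 1 - \<theta>\<^sup>2"
    unfolding eventually_at_right_field using r0 by blast
  from tendsto_upperbound[OF lim this] have "1 \<le> 1 - \<theta>\<^sup>2" by simp
  then show False using \<theta> by simp
qed

lemma cnj_image_iff: "z \<in> cnj ` A \<longleftrightarrow> cnj z \<in> A"
  by (metis complex_cnj_cnj image_iff)

lemma dist_cnj: "dist (cnj a) (cnj b) = dist a b"
  by (metis complex_cnj_diff complex_mod_cnj dist_norm)

subsection \<open>The rotated complex gradient\<close>

text \<open>
  For a unit complex number \<open>\<omega>\<close>, \<open>c\<close> stands for the gradient \<open>u\<^sub>x + \<i> u\<^sub>y\<close> in coordinates rotated by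
  \<open>\<omega>\<close>. Symmetry and trace one of the Hessian mean exactly that its differential is
  \<open>h \<mapsto> h/2 + \<kappa> cnj h\<close>; the rotation makes the limit of \<open>\<kappa>\<close> at the base point a nonpositive
  number \<open>-k\<close>, so that the limiting Hessian is diagonal with eigenvalues \<open>1/2 - k\<close> and \<open>1/2 + k\<close>.
\<close>

locale hodograph =
  fixes W :: "complex set" and c \<kappa> :: "complex \<Rightarrow> complex" and \<rho> k \<epsilon> L :: real
  assumes rho: "0 < \<rho>" and k0: "0 \<le> k" and eps: "0 < \<epsilon>" "\<epsilon> \<le> 1/20" and L0: "0 < L"
    and W_open: "open W" and W_sub: "W \<subseteq> ball 0 \<rho>"
    and lip: "\<And>z w. z \<in> ball 0 \<rho> \<Longrightarrow> w \<in> ball 0 \<rho> \<Longrightarrow> norm (c z - c w) \<le> L * dist z w"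
    and zero: "\<And>z. z \<in> ball 0 \<rho> \<Longrightarrow> z \<notin> W \<Longrightarrow> c z = 0"
    and der: "\<And>z. z \<in> W \<Longrightarrow> (c has_derivative (\<lambda>h. h/2 + \<kappa> z * cnj h)) (at z)"
    and kap: "\<And>z. z \<in> W \<Longrightarrow> norm (\<kappa> z + of_real k) \<le> \<epsilon>"
begin

definition P :: "complex set" where
  "P = {z \<in> ball 0 \<rho>. 0 < Im (c z)}"

lemma c_cont: "continuous_on (ball 0 \<rho>) c"
proof -
  have "L-lipschitz_on (ball 0 \<rho>) c"
    using lip L0 by (auto simp: lipschitz_on_def dist_norm)
  then show ?thesis by (rule lipschitz_on_continuous_on)
qed

lemma P_sub: "P \<subseteq> W" "P \<subseteq> ball 0 \<rho>"
  using zero by (force simp: P_def)+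

lemma P_open: "open P"
proof -
  have "open (ball 0 \<rho> \<inter> (\<lambda>z. Im (c z)) -` {0<..})"
    by (intro continuous_open_preimage continuous_intros c_cont) auto
  then show ?thesis by (simp add: P_def vimage_def Int_def)
qed

lemma deriv_along:
  assumes "z + of_real t * h \<in> W"
  shows "((\<lambda>t. Im (c (z + of_real t * h))) has_real_derivative
           Im (h/2 + \<kappa> (z + of_real t * h) * cnj h)) (at t)"
proof -
  have c: "(c has_derivative (\<lambda>h'. h'/2 + \<kappa> (z + of_real t * h) * cnj h')) (at (z + of_real t * h))"
    using der assms by blast
  have l: "((\<lambda>t. z + of_real t * h) has_derivative (\<lambda>s. of_real s * h)) (at t)"
    by (auto intro!: derivative_eq_intros)
  have "((\<lambda>t. Im (c (z + of_real t * h))) has_derivative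
          (\<lambda>s. Im ((of_real s * h)/2 + \<kappa> (z + of_real t * h) * cnj (of_real s * h)))) (at t)"
    by (rule has_derivative_Im[OF has_derivative_compose[OF l c]])
  moreover have "(\<lambda>s. Im ((of_real s * h)/2 + \<kappa> (z + of_real t * h) * cnj (of_real s * h)))
      = (*) (Im (h/2 + \<kappa> (z + of_real t * h) * cnj h))"
    by (auto simp: fun_eq_iff algebra_simps)
  ultimately show ?thesis by (simp add: has_field_derivative_def)
qed

lemma deriv_cone:
  assumes "z \<in> W" "\<bar>Re h\<bar> \<le> Im h"
  shows "Im h / 4 \<le> Im (h/2 + \<kappa> z * cnj h)"
proof -
  have "norm h \<le> \<bar>Re h\<bar> + \<bar>Im h\<bar>" by (rule cmod_le)
  with assms have "norm h \<le> 2 * Im h" by simp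
  moreover have "\<bar>Im ((\<kappa> z + of_real k) * cnj h)\<bar> \<le> \<epsilon> * norm h"
    using abs_Im_le_cmod[of "(\<kappa> z + of_real k) * cnj h"] kap[OF assms(1)]
    by (simp add: norm_mult) (meson mult_right_mono norm_ge_zero order_trans)
  moreover have "\<epsilon> * norm h \<le> 1/20 * norm h"
    using eps by (intro mult_right_mono) auto
  moreover have "0 \<le> k * Im h" using k0 assms by auto
  moreover have "Im (h/2 + \<kappa> z * cnj h) = Im h / 2 + k * Im h + Im ((\<kappa> z + of_real k) * cnj h)"
    by (simp add: algebra_simps)
  ultimately show ?thesis by linarith
qed

lemma cont_along:
  assumes "\<And>t. t \<in> S \<Longrightarrow> z + of_real t * h \<in> ball 0 \<rho>"
  shows "continuous_on S (\<lambda>t. Im (c (z + of_real t * h)))"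
  using assms
  by (intro continuous_on_Im continuous_on_compose2[OF c_cont] continuous_intros) auto

lemma segment_in_ball:
  fixes z h :: complex
  assumes "z \<in> ball 0 \<rho>" "z + h \<in> ball 0 \<rho>" "0 \<le> t" "t \<le> 1"
  shows "z + of_real t * h \<in> ball 0 \<rho>"
proof -
  have "(1 - t) *\<^sub>R z + t *\<^sub>R (z + h) \<in> ball 0 \<rho>"
    using assms convexD[OF convex_ball[of "0::complex" \<rho>], of z "z + h" "1 - t" t] by auto
  then show ?thesis by (simp add: algebra_simps scaleR_conv_of_real)
qed

lemma growth:
  assumes "a \<le> b" "\<bar>Re h\<bar> \<le> Im h"
    and "\<And>t. a \<le> t \<Longrightarrow> t \<le> b \<Longrightarrow> z + of_real t * h \<in> ball 0 \<rho>"
    and "\<And>t. a < t \<Longrightarrow> t < b \<Longrightarrow> z + of_real t * h \<in> W"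
  shows "Im (c (z + of_real a * h)) + (b - a) * (Im h / 4) \<le> Im (c (z + of_real b * h))"
proof (cases "a < b")
  case True
  let ?f = "\<lambda>t. Im (c (z + of_real t * h))"
  have "\<exists>l x. a < x \<and> x < b \<and> (?f has_real_derivative l) (at x) \<and> ?f b - ?f a = (b - a) * l"
  proof (rule MVT[OF True])
    show "continuous_on {a..b} ?f" using assms by (intro cont_along) auto
    show "?f differentiable (at x)" if "a < x" "x < b" for x
      using deriv_along[OF assms(4)[OF that]] real_differentiable_def by blast
  qed
  then obtain l x where x: "a < x" "x < b" "(?f has_real_derivative l) (at x)"
    and e: "?f b - ?f a = (b - a) * l" by blast
  have "l = Im (h/2 + \<kappa> (z + of_real x * h) * cnj h)"
    using DERIV_unique[OF x(3) deriv_along[OF assms(4)[OF x(1,2)]]] .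
  then have "Im h / 4 \<le> l" using deriv_cone[OF assms(4)[OF x(1,2)] assms(2)] by simp
  then have "(b - a) * (Im h / 4) \<le> (b - a) * l" using True by (intro mult_left_mono) auto
  with e show ?thesis by linarith
next
  case False
  with assms(1) show ?thesis by simp
qed

lemma cone_segment:
  assumes z: "z \<in> P" and h: "\<bar>Re h\<bar> \<le> Im h" and zh: "z + h \<in> ball 0 \<rho>"
    and t: "0 \<le> t" "t \<le> 1"
  shows "z + of_real t * h \<in> P"
proof (rule ccontr)
  assume n: "z + of_real t * h \<notin> P"
  let ?f = "\<lambda>t. Im (c (z + of_real t * h))"
  have z': "z \<in> ball 0 \<rho>" using z P_sub by blast
  have inb: "z + of_real s * h \<in> ball 0 \<rho>" if "0 \<le> s" "s \<le> 1" for s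
    using segment_in_ball[OF z' zh that] .
  let ?T = "{0..1} \<inter> ?f -` {..0}"
  have cl: "closed ?T"
    by (intro continuous_closed_preimage cont_along inb) auto
  have ne: "?T \<noteq> {}" using n t inb[of t] by (force simp: P_def)
  have bd: "bdd_below ?T" by (meson bdd_below_Int1 bdd_below_Icc)
  define s where "s = Inf ?T"
  have s: "s \<in> ?T" unfolding s_def by (rule closed_contains_Inf[OF ne bd cl])
  have below: "z + of_real r * h \<in> P" if "0 \<le> r" "r < s" for r
  proof (rule ccontr)
    assume "z + of_real r * h \<notin> P"
    then have "r \<in> ?T" using that s inb[of r] by (auto simp: P_def not_less)
    then have "s \<le> r" unfolding s_def using bd by (rule cInf_lower)
    with that show False by simp
  qed
  have "?f 0 + (s - 0) * (Im h / 4) \<le> ?f s"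
    by (rule growth) (use s h inb below P_sub in auto)
  moreover have "0 < ?f 0" using z by (simp add: P_def)
  moreover have "0 \<le> s * (Im h / 4)" using s h by simp
  ultimately show False using s by simp
qed

lemma cone_step:
  assumes z: "z \<in> P" and h: "\<bar>Re h\<bar> \<le> Im h" and zh: "z + h \<in> ball 0 \<rho>"
  shows "z + h \<in> P" "Im (c z) + Im h / 4 \<le> Im (c (z + h))"
proof -
  show "z + h \<in> P" using cone_segment[OF assms, of 1] by simp
  have "Im (c (z + of_real 0 * h)) + (1 - 0) * (Im h / 4) \<le> Im (c (z + of_real 1 * h))"
  proof (rule growth)
    fix t :: real assume "0 \<le> t" "t \<le> 1"
    then show "z + of_real t * h \<in> ball 0 \<rho>" using cone_segment[OF assms] P_sub by blast
  next
    fix t :: real assume "0 < t" "t < 1"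
    then show "z + of_real t * h \<in> W" using cone_segment[OF assms, of t] P_sub by (simp add: subset_eq)
  qed (use h in auto)
  then show "Im (c z) + Im h / 4 \<le> Im (c (z + h))" by simp
qed

lemma upward:
  assumes z: "z \<in> W" and c: "0 \<le> Im (c z)" and s: "0 < s" and zs: "z + \<i> * of_real s \<in> ball 0 \<rho>"
  shows "z + \<i> * of_real s \<in> P" "s \<le> 4 * Im (c (z + \<i> * of_real s))"
proof -
  have "s / 4 \<le> Im (c (z + \<i> * of_real s))"
  proof (cases "0 < Im (c z)")
    case True
    then have "z \<in> P" using z W_sub by (auto simp: P_def)
    from cone_step(2)[OF this, of "\<i> * of_real s"] zs s c show ?thesis by simp
  next
    case False
    with c have c0: "Im (c z) = 0" by simp
    let ?f = "\<lambda>t. Im (c (z + of_real t * \<i>))"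
    have zW: "z + of_real 0 * \<i> \<in> W" using z by simp
    have "0 < Im (\<i>/2 + \<kappa> (z + of_real 0 * \<i>) * cnj \<i>)"
      using deriv_cone[OF zW, of \<i>] by simp
    from DERIV_pos_inc_right[OF deriv_along[OF zW] this] c0
    obtain d where d: "0 < d" and pos: "\<And>t. 0 < t \<Longrightarrow> t < d \<Longrightarrow> 0 < ?f t" by auto
    have "(s - t) / 4 \<le> Im (c (z + \<i> * of_real s))" if t: "0 < t" "t < min d s" for t
    proof -
      have "z + of_real (t/s) * (\<i> * of_real s) \<in> ball 0 \<rho>"
        using z W_sub zs t s by (intro segment_in_ball) auto
      then have "z + of_real t * \<i> \<in> ball 0 \<rho>" using s by (simp add: mult.commute)
      then have p: "z + of_real t * \<i> \<in> P" using pos t by (auto simp: P_def)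
      have e: "z + of_real t * \<i> + \<i> * of_real (s - t) = z + \<i> * of_real s"
        by (simp add: algebra_simps)
      have "Im (c (z + of_real t * \<i>)) + (s - t) / 4 \<le> Im (c (z + \<i> * of_real s))"
        using cone_step(2)[OF p, of "\<i> * of_real (s - t)"] t zs unfolding e by simp
      moreover have "0 < ?f t" using pos t by simp
      ultimately show ?thesis by linarith
    qed
    note * = this
    show ?thesis
    proof (rule ccontr)
      assume n: "\<not> ?thesis"
      define t where "t = min (min d s / 2) ((s / 4 - Im (c (z + \<i> * of_real s))))"
      have "0 < t" "t < min d s" using n d s by (auto simp: t_def)
      from *[OF this] have "(s - t) / 4 \<le> Im (c (z + \<i> * of_real s))" .
      moreover have "t \<le> s / 4 - Im (c (z + \<i> * of_real s))" by (simp add: t_def)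
      ultimately show False using \<open>0 < t\<close> by (simp add: field_simps)
    qed
  qed
  then show "s \<le> 4 * Im (c (z + \<i> * of_real s))" "z + \<i> * of_real s \<in> P"
    using s zs by (auto simp: P_def)
qed

lemma closure_P_upward:
  assumes z: "z \<in> closure P" and h: "\<bar>Re h\<bar> < Im h" and zh: "z + h \<in> ball 0 \<rho>"
  shows "z + h \<in> P"
proof -
  have "0 < (Im h - \<bar>Re h\<bar>) / 2" using h by simp
  from z this obtain w where w: "w \<in> P" "dist w z < (Im h - \<bar>Re h\<bar>) / 2"
    unfolding closure_approachable by blast
  have "\<bar>Re (z - w)\<bar> \<le> dist w z" "\<bar>Im (z - w)\<bar> \<le> dist w z"
    by (metis abs_Re_le_cmod dist_commute dist_norm, metis abs_Im_le_cmod dist_commute dist_norm)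
  then have "\<bar>Re (z + h - w)\<bar> \<le> Im (z + h - w)"
    using w h by (simp; linarith)
  from cone_step(1)[OF w(1) this] zh show ?thesis by simp
qed

lemma free_above_P:
  assumes n: "n \<notin> W" "n \<in> ball 0 \<rho>" and s: "0 < s" "n + \<i> * of_real s \<in> ball 0 \<rho>"
    and free: "\<And>t. 0 < t \<Longrightarrow> t \<le> s \<Longrightarrow> n + \<i> * of_real t \<in> W"
  shows "n \<in> closure P"
proof -
  have P: "n + \<i> * of_real t \<in> P" if t: "0 < t" "t \<le> s" for t
  proof -
    have "Im (c (n + of_real 0 * \<i>)) + (t - 0) * (Im \<i> / 4) \<le> Im (c (n + of_real t * \<i>))"
    proof (rule growth)
      show "n + of_real r * \<i> \<in> W" if "0 < r" "r < t" for r
        using free[of r] that t by (simp add: mult.commute)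
      show "n + of_real r * \<i> \<in> ball 0 \<rho>" if "0 \<le> r" "r \<le> t" for r
        using free[of r] that t W_sub n by (cases "r = 0") (auto simp: mult.commute)
    qed (use t in auto)
    then have "0 < Im (c (n + \<i> * of_real t))" using zero[OF n(2,1)] t by (simp add: mult.commute)
    then show ?thesis using free[OF t] W_sub by (auto simp: P_def)
  qed
  have "\<exists>y\<in>P. dist y n < e" if "0 < e" for e
    using P[of "min (e/2) s"] that s by (intro bexI[of _ "n + \<i> * of_real (min (e/2) s)"]) (auto simp: dist_norm norm_mult)
  then show ?thesis unfolding closure_approachable by blast
qed

lemma top_point:
  assumes n: "n \<notin> W" "n \<in> ball 0 \<rho>" and s: "0 < s" "n + \<i> * of_real s \<in> P"
  obtains t where "0 \<le> t" "t < s" "n + \<i> * of_real t \<notin> W" "n + \<i> * of_real t \<in> closure P"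
    "\<And>r. 0 \<le> r \<Longrightarrow> r \<le> s \<Longrightarrow> n + \<i> * of_real r \<notin> W \<Longrightarrow> r \<le> t"
proof -
  let ?T = "{0..s} \<inter> (\<lambda>t. n + \<i> * of_real t) -` (- W)"
  have cl: "closed ?T"
    by (intro continuous_closed_preimage continuous_intros) (use W_open in auto)
  have ne: "?T \<noteq> {}" using n s by (force intro: exI[of _ 0])
  have bd: "bdd_above ?T" by (meson bdd_above_Int1 bdd_above_Icc)
  define t where "t = Sup ?T"
  have t: "t \<in> ?T" unfolding t_def by (rule closed_contains_Sup[OF ne bd cl])
  have le: "r \<le> t" if "r \<in> ?T" for r
    unfolding t_def using that bd by (rule cSup_upper)
  have "t \<noteq> s" using t s P_sub by auto
  then have ts: "t < s" using t by auto
  let ?m = "n + \<i> * of_real t"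
  have e: "?m + \<i> * of_real r = n + \<i> * of_real (t + r)" for r by (simp add: algebra_simps)
  have sb: "n + \<i> * of_real s \<in> ball 0 \<rho>" using s P_sub by blast
  have "?m \<in> closure P"
  proof (rule free_above_P)
    show "?m \<notin> W" using t by auto
    have "n + of_real (t/s) * (\<i> * of_real s) \<in> ball 0 \<rho>"
      using n sb t s by (intro segment_in_ball) auto
    then show "?m \<in> ball 0 \<rho>" using s by (simp add: mult.commute)
    show "0 < s - t" using ts by simp
    show "?m + \<i> * of_real (s - t) \<in> ball 0 \<rho>" using sb by (simp add: algebra_simps)
    show "?m + \<i> * of_real r \<in> W" if r: "0 < r" "r \<le> s - t" for r
    proof (rule ccontr)
      assume "?m + \<i> * of_real r \<notin> W"
      then have "t + r \<in> ?T" using r t by (auto simp: e)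
      from le[OF this] r show False by simp
    qed
  qed
  with t ts le show ?thesis by (intro that[of t]) auto
qed

text \<open>
  The segment from \<open>z1\<close> to \<open>z2\<close> may leave \<open>P\<close>, but a point of the intersection of the upward cones at
  \<open>z1\<close> and \<open>z2\<close> can be reached from both inside \<open>P\<close>.
\<close>

lemma c_affine_on_P:
  assumes z1: "z1 \<in> P" "norm z1 < \<rho> / 5" and z2: "z2 \<in> P" "norm z2 < \<rho> / 5"
  shows "norm ((c z1 - z1 / 2 + k * cnj z1) - (c z2 - z2 / 2 + k * cnj z2)) \<le> 5 * \<epsilon> * norm (z1 - z2)"
proof -
  let ?F = "\<lambda>z. c z - z / 2 + k * cnj z"
  have seg: "norm (?F (z + h) - ?F z) \<le> \<epsilon> * norm h"
    if z: "z \<in> P" and h: "\<bar>Re h\<bar> \<le> Im h" and zh: "z + h \<in> ball 0 \<rho>" for z h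
  proof -
    have "norm (?F (z + h) - ?F z) \<le> \<epsilon> * norm (z + h - z)"
    proof (rule differentiable_bound[of "closed_segment z (z + h)" ?F "\<lambda>w h. (\<kappa> w + k) * cnj h"])
      fix w assume "w \<in> closed_segment z (z + h)"
      then obtain t where t: "0 \<le> t" "t \<le> 1" "w = z + of_real t * h"
        by (auto simp: closed_segment_def scaleR_conv_of_real algebra_simps)
      then have w: "w \<in> W" using cone_segment[OF z h zh] P_sub by blast
      have "(?F has_derivative (\<lambda>h. (\<kappa> w + k) * cnj h)) (at w)"
        by (rule derivative_eq_intros der[OF w] refl | simp add: algebra_simps)+
      then show "(?F has_derivative (\<lambda>h. (\<kappa> w + k) * cnj h)) (at w within closed_segment z (z + h))"
        by (rule has_derivative_at_withinI)
      show "onorm (\<lambda>h. (\<kappa> w + k) * cnj h) \<le> \<epsilon>"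
        by (rule onorm_le) (use kap[OF w] in \<open>simp add: norm_mult mult_right_mono\<close>)
    qed auto
    then show ?thesis by simp
  qed
  have tri: "norm (a - b) \<le> norm (q - a) + norm (q - b)" for a b q :: complex
    using norm_triangle_ineq4[of "q - b" "q - a"] by simp
  define d where "d = norm (z1 - z2)"
  define x where "x = Re z1 - Re z2"
  define y where "y = max (Im z1) (Im z2) + \<bar>x\<bar>"
  define p where "p = Complex (Re z1) y"
  have x: "\<bar>x\<bar> \<le> d" and y: "\<bar>Im z1 - Im z2\<bar> \<le> d"
    using abs_Re_le_cmod[of "z1 - z2"] abs_Im_le_cmod[of "z1 - z2"] by (auto simp: d_def x_def)
  have "norm (p - z1) \<le> \<bar>Re (p - z1)\<bar> + \<bar>Im (p - z1)\<bar>" by (rule cmod_le)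
  then have n1: "norm (p - z1) \<le> 2 * d" using x y by (simp add: p_def y_def)
  have "norm (p - z2) \<le> \<bar>Re (p - z2)\<bar> + \<bar>Im (p - z2)\<bar>" by (rule cmod_le)
  then have n2: "norm (p - z2) \<le> 3 * d" using x y by (simp add: p_def y_def x_def max_def split: if_splits)
  have "d < 2 * (\<rho> / 5)" using norm_triangle_ineq4[of z1 z2] z1 z2 by (simp add: d_def)
  then have "norm p < \<rho>" using n1 z1 norm_triangle_ineq[of z1 "p - z1"] by simp
  then have pb: "p \<in> ball 0 \<rho>" by simp
  have "norm (?F p - ?F z1) \<le> \<epsilon> * norm (p - z1)"
    using seg[OF z1(1), of "p - z1"] pb by (simp add: p_def y_def)
  moreover have "norm (?F p - ?F z2) \<le> \<epsilon> * norm (p - z2)"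
    using seg[OF z2(1), of "p - z2"] pb by (simp add: p_def y_def x_def)
  moreover have "\<epsilon> * norm (p - z1) \<le> \<epsilon> * (2 * d)" "\<epsilon> * norm (p - z2) \<le> \<epsilon> * (3 * d)"
    using n1 n2 eps by (auto intro: mult_left_mono)
  moreover have "norm (?F z1 - ?F z2) \<le> norm (?F p - ?F z1) + norm (?F p - ?F z2)"
    by (rule tri)
  ultimately show ?thesis by (simp add: d_def)
qed

lemma c_affine_on_closure_P:
  assumes z1: "z1 \<in> closure P" "norm z1 < \<rho> / 5" and z2: "z2 \<in> closure P" "norm z2 < \<rho> / 5"
  shows "norm ((c z1 - z1 / 2 + k * cnj z1) - (c z2 - z2 / 2 + k * cnj z2)) \<le> 5 * \<epsilon> * norm (z1 - z2)"
proof -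
  let ?F = "\<lambda>z. c z - z / 2 + k * cnj z"
  have lim: "((\<lambda>t. ?F (z + \<i> * of_real t)) \<longlongrightarrow> ?F z) (at_right 0)" if z: "norm z < \<rho> / 5" for z
  proof -
    have l: "((\<lambda>t. z + \<i> * of_real t) \<longlongrightarrow> z + \<i> * of_real 0) (at_right 0)"
      by (intro tendsto_intros)
    have "isCont c z"
      using c_cont z rho by (simp add: continuous_on_eq_continuous_at)
    then have "((\<lambda>t. c (z + \<i> * of_real t)) \<longlongrightarrow> c z) (at_right 0)"
      using l by (intro isCont_tendsto_compose[of z c]) auto
    then show ?thesis using l tendsto_cnj[OF l] by (auto intro!: tendsto_intros)
  qed
  define d where "d = \<rho> / 5 - max (norm z1) (norm z2)"
  have d: "0 < d" using z1 z2 by (simp add: d_def)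
  have near: "z + \<i> * of_real t \<in> P" "norm (z + \<i> * of_real t) < \<rho> / 5"
    if "z \<in> closure P" "norm z \<le> max (norm z1) (norm z2)" "0 < t" "t < d" for z t
  proof -
    have "norm (z + \<i> * of_real t) \<le> norm z + t"
      using norm_triangle_ineq[of z "\<i> * of_real t"] that by (simp add: norm_mult)
    then show n: "norm (z + \<i> * of_real t) < \<rho> / 5" using that by (simp add: d_def)
    show "z + \<i> * of_real t \<in> P"
      by (rule closure_P_upward) (use that n rho in auto)
  qed
  show ?thesis
  proof (rule tendsto_upperbound)
    show "((\<lambda>t. norm (?F (z1 + \<i> * of_real t) - ?F (z2 + \<i> * of_real t))) \<longlongrightarrow> norm (?F z1 - ?F z2)) (at_right 0)"
      by (intro tendsto_intros lim z1 z2)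
    show "\<forall>\<^sub>F t in at_right 0. norm (?F (z1 + \<i> * of_real t) - ?F (z2 + \<i> * of_real t)) \<le> 5 * \<epsilon> * norm (z1 - z2)"
      unfolding eventually_at_right_field
    proof (intro exI[of _ d] conjI allI impI)
      fix t assume t: "0 < t" "t < d"
      show "norm (?F (z1 + \<i> * of_real t) - ?F (z2 + \<i> * of_real t)) \<le> 5 * \<epsilon> * norm (z1 - z2)"
        using c_affine_on_P[OF near[OF z1(1) _ t] near[OF z2(1) _ t]] by simp
    qed (rule d)
  qed simp
qed


lemma flip: "hodograph (cnj ` W) (\<lambda>z. cnj (c (cnj z))) (\<lambda>z. cnj (\<kappa> (cnj z))) \<rho> k \<epsilon> L"
proof
  have e: "cnj ` W = cnj -` W" by (auto simp: cnj_image_iff)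
  show "open (cnj ` W)" unfolding e by (intro open_vimage W_open continuous_intros)
  show "cnj ` W \<subseteq> ball 0 \<rho>" using W_sub by auto
  show "norm (cnj (c (cnj z)) - cnj (c (cnj w))) \<le> L * dist z w"
    if "z \<in> ball 0 \<rho>" "w \<in> ball 0 \<rho>" for z w
    using lip[of "cnj z" "cnj w"] that
    by (simp add: dist_norm flip: complex_cnj_diff)
  show "cnj (c (cnj z)) = 0" if "z \<in> ball 0 \<rho>" "z \<notin> cnj ` W" for z
    using that zero[of "cnj z"] by (simp add: cnj_image_iff)
  show "norm (cnj (\<kappa> (cnj z)) + of_real k) \<le> \<epsilon>" if "z \<in> cnj ` W" for z
  proof -
    have "norm (cnj (\<kappa> (cnj z) + of_real k)) \<le> \<epsilon>"
      using kap[of "cnj z"] that by (simp only: complex_mod_cnj cnj_image_iff)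
    then show ?thesis by simp
  qed
  show "((\<lambda>z. cnj (c (cnj z))) has_derivative (\<lambda>h. h / 2 + cnj (\<kappa> (cnj z)) * cnj h)) (at z)"
    if "z \<in> cnj ` W" for z
  proof -
    have "(cnj has_derivative cnj) (at z)"
      by (rule bounded_linear_imp_has_derivative[OF bounded_linear_cnj])
    then have "((\<lambda>z. c (cnj z)) has_derivative (\<lambda>h. cnj h / 2 + \<kappa> (cnj z) * cnj (cnj h))) (at z)"
      by (rule has_derivative_compose[OF _ der]) (use that in \<open>simp add: cnj_image_iff\<close>)
    from has_derivative_cnj[OF this]
    have "((\<lambda>z. cnj (c (cnj z))) has_derivative (\<lambda>h. cnj (cnj h / 2 + \<kappa> (cnj z) * cnj (cnj h)))) (at z)" .
    moreover have "(\<lambda>h. cnj (cnj h / 2 + \<kappa> (cnj z) * cnj (cnj h))) = (\<lambda>h. h / 2 + cnj (\<kappa> (cnj z)) * cnj h)"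
      by (simp add: fun_eq_iff)
    ultimately show ?thesis by (simp only:)
  qed
qed (use rho k0 eps L0 in auto)

lemma not_W_between:
  assumes z: "z \<in> ball 0 \<rho>" "z \<notin> W" and d: "z + \<i> * of_real d \<in> ball 0 \<rho>" "z + \<i> * of_real d \<notin> W"
    and h: "z + of_real h \<in> ball 0 \<rho>" "z + of_real h + \<i> * of_real d \<in> ball 0 \<rho>"
    and y: "4 * L * \<bar>h\<bar> < y" "y < d - 4 * L * \<bar>h\<bar>"
  shows "z + of_real h + \<i> * of_real y \<notin> W"
proof
  let ?m = "z + of_real h + \<i> * of_real y"
  assume m: "?m \<in> W"
  have Lh: "0 \<le> 4 * L * \<bar>h\<bar>" using L0 by simp
  have small: "\<bar>Im (c (q + of_real h))\<bar> \<le> L * \<bar>h\<bar>"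
    if "q \<in> ball 0 \<rho>" "q \<notin> W" "q + of_real h \<in> ball 0 \<rho>" for q
  proof -
    have "norm (c (q + of_real h) - c q) \<le> L * dist (q + of_real h) q"
      by (rule lip) (use that in auto)
    then show ?thesis
      using zero[OF that(1,2)] abs_Im_le_cmod[of "c (q + of_real h)"] by (simp add: dist_norm)
  qed
  show False
  proof (cases "0 \<le> Im (c ?m)")
    case True
    have e: "?m + \<i> * of_real (d - y) = z + \<i> * of_real d + of_real h"
      by (simp add: algebra_simps)
    have b: "z + \<i> * of_real d + of_real h \<in> ball 0 \<rho>" using h(2) by (simp add: ac_simps)
    have "d - y \<le> 4 * Im (c (?m + \<i> * of_real (d - y)))"
    proof (rule upward(2)[OF m True])
      show "0 < d - y" using y Lh by linarith
      show "?m + \<i> * of_real (d - y) \<in> ball 0 \<rho>" unfolding e by (rule b)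
    qed
    then show False using small[OF d b] y unfolding e by linarith
  next
    case False
    interpret F: hodograph "cnj ` W" "\<lambda>z. cnj (c (cnj z))" "\<lambda>z. cnj (\<kappa> (cnj z))" \<rho> k \<epsilon> L
      by (rule flip)
    have e: "cnj ?m + \<i> * of_real y = cnj (z + of_real h)"
      by simp
    have "y \<le> 4 * Im (cnj (c (cnj (cnj ?m + \<i> * of_real y))))"
    proof (rule F.upward(2))
      show "cnj ?m \<in> cnj ` W" using m by blast
      show "0 \<le> Im (cnj (c (cnj (cnj ?m))))" using False by simp
      show "0 < y" using y Lh by simp
      show "cnj ?m + \<i> * of_real y \<in> ball 0 \<rho>" unfolding e using h by (simp del: complex_cnj_add)
    qed
    then have "y \<le> 4 * - Im (c (z + of_real h))" unfolding e by simp
    then show False using small[OF z h(1)] y by linarith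
  qed
qed

lemma complement_fat_above:
  assumes z: "z \<in> ball 0 \<rho>" "z \<notin> W" and d: "z + \<i> * of_real d \<in> ball 0 \<rho>" "z + \<i> * of_real d \<notin> W"
    and d0: "0 < d"
  shows "\<exists>\<theta>>0. \<theta> < 1/2 \<and> (\<exists>r0>0. \<forall>r. 0 < r \<longrightarrow> r < r0 \<longrightarrow>
           (\<exists>y. dist y z \<le> r/2 \<and> ball y (\<theta> * r) \<subseteq> ball 0 \<rho> - W))"
proof -
  define \<theta> where "\<theta> = 1 / (4 + 8 * L)"
  have \<theta>: "0 < \<theta>" "\<theta> < 1/2" "4 * L * \<theta> + \<theta> < 1/2"
    using L0 by (auto simp: \<theta>_def field_simps)
  let ?q = "z + \<i> * of_real d"
  define r0 where "r0 = min (min (\<rho> - norm z) (\<rho> - norm ?q)) (d / 2)"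
  have r0: "0 < r0" using z d d0 by (simp add: r0_def)
  have "\<exists>y. dist y z \<le> r/2 \<and> ball y (\<theta> * r) \<subseteq> ball 0 \<rho> - W" if r: "0 < r" "r < r0" for r
  proof (intro exI conjI subsetI)
    let ?y = "z + \<i> * of_real (r/2)"
    show "dist ?y z \<le> r / 2" using r by (simp add: dist_norm norm_mult norm_divide)
    fix w assume w: "w \<in> ball ?y (\<theta> * r)"
    define h where "h = Re (w - z)"
    define y where "y = Im (w - z)"
    have wd: "w = z + of_real h + \<i> * of_real y" by (simp add: h_def y_def complex_eq_iff)
    have "\<bar>Re (w - ?y)\<bar> < \<theta> * r" "\<bar>Im (w - ?y)\<bar> < \<theta> * r"
      using w abs_Re_le_cmod[of "w - ?y"] abs_Im_le_cmod[of "w - ?y"]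
      by (auto simp: dist_norm norm_minus_commute)
    then have hy: "\<bar>h\<bar> < \<theta> * r" "\<bar>y - r/2\<bar> < \<theta> * r"
      by (auto simp: h_def y_def)
    have \<theta>r: "\<theta> * r < 1/2 * r" using \<theta> r by (intro mult_strict_right_mono) auto
    have "4 * L * \<bar>h\<bar> \<le> 4 * L * (\<theta> * r)" using hy L0 by (intro mult_left_mono) auto
    moreover have "(4 * L * \<theta> + \<theta>) * r < 1/2 * r" using \<theta> r by (intro mult_strict_right_mono) auto
    ultimately have *: "4 * L * \<bar>h\<bar> + \<theta> * r < r / 2" by (simp add: algebra_simps)
    have hr: "\<bar>h\<bar> < r" using hy \<theta>r r by linarith
    have r': "r < \<rho> - norm z" "r < \<rho> - norm ?q" "r < d/2" using r by (auto simp: r0_def)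
    have "w \<notin> W" unfolding wd
    proof (rule not_W_between[OF z d])
      show "z + of_real h \<in> ball 0 \<rho>" using norm_triangle_ineq[of z "of_real h"] hr r' by simp
      have "norm (?q + of_real h) < \<rho>"
        using norm_triangle_ineq[of ?q "of_real h"] hr r' by simp
      then show "z + of_real h + \<i> * of_real d \<in> ball 0 \<rho>" by (simp add: ac_simps)
      show "4 * L * \<bar>h\<bar> < y" "y < d - 4 * L * \<bar>h\<bar>" using * hy r' \<theta>r by linarith+
    qed
    moreover have "norm w \<le> norm ?y + \<theta> * r"
      using w norm_triangle_ineq[of ?y "w - ?y"] by (simp add: dist_norm norm_minus_commute)
    moreover have "norm ?y \<le> norm z + r/2"
      using norm_triangle_ineq[of z "\<i> * of_real (r/2)"] r by (simp add: norm_mult norm_divide)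
    ultimately have "w \<notin> W" "norm w < \<rho>" using r' \<theta>r by linarith+
    then show "w \<in> ball 0 \<rho> - W" by simp
  qed
  then show ?thesis using \<theta> r0 by blast
qed

lemma complement_fat_of_column:
  assumes z: "z \<in> ball 0 \<rho>" "z \<notin> W" and q: "q \<in> ball 0 \<rho>" "q \<notin> W" and "Re q = Re z" "q \<noteq> z"
  shows "\<exists>\<theta>>0. \<theta> < 1/2 \<and> (\<exists>r0>0. \<forall>r. 0 < r \<longrightarrow> r < r0 \<longrightarrow>
           (\<exists>y. dist y z \<le> r/2 \<and> ball y (\<theta> * r) \<subseteq> ball 0 \<rho> - W))"
proof (cases "Im z < Im q")
  case True
  have "q = z + \<i> * of_real (Im q - Im z)" using assms by (simp add: complex_eq_iff)
  then show ?thesis using complement_fat_above[OF z, of "Im q - Im z"] q True by simp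
next
  case False
  then have less: "Im q < Im z" using assms by (simp add: complex_eq_iff)
  interpret F: hodograph "cnj ` W" "\<lambda>z. cnj (c (cnj z))" "\<lambda>z. cnj (\<kappa> (cnj z))" \<rho> k \<epsilon> L
    by (rule flip)
  have e: "cnj q = cnj z + \<i> * of_real (Im z - Im q)" using assms by (simp add: complex_eq_iff)
  have "\<exists>\<theta>>0. \<theta> < 1/2 \<and> (\<exists>r0>0. \<forall>r. 0 < r \<longrightarrow> r < r0 \<longrightarrow>
           (\<exists>y. dist y (cnj z) \<le> r/2 \<and> ball y (\<theta> * r) \<subseteq> ball 0 \<rho> - cnj ` W))"
    by (rule F.complement_fat_above[of "cnj z" "Im z - Im q"]) (unfold e[symmetric], use z q less in \<open>simp_all add: cnj_image_iff\<close>)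
  then obtain \<theta> r0 where \<theta>: "0 < \<theta>" "\<theta> < 1/2" "0 < r0"
    and *: "\<And>r. 0 < r \<Longrightarrow> r < r0 \<Longrightarrow> \<exists>y. dist y (cnj z) \<le> r/2 \<and> ball y (\<theta> * r) \<subseteq> ball 0 \<rho> - cnj ` W"
    by blast
  have "\<exists>y. dist y z \<le> r/2 \<and> ball y (\<theta> * r) \<subseteq> ball 0 \<rho> - W" if "0 < r" "r < r0" for r
  proof -
    from *[OF that] obtain y where y: "dist y (cnj z) \<le> r/2" "ball y (\<theta> * r) \<subseteq> ball 0 \<rho> - cnj ` W" by blast
    have "dist (cnj y) z \<le> r/2" using y(1) dist_cnj[of "cnj y" z] by simp
    moreover have "w \<in> ball 0 \<rho> - W" if "w \<in> ball (cnj y) (\<theta> * r)" for w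
    proof -
      have "cnj w \<in> ball y (\<theta> * r)" using that dist_cnj[of "cnj y" w] by simp
      then have "cnj w \<in> ball 0 \<rho> - cnj ` W" using y(2) by blast
      then show ?thesis by (simp add: cnj_image_iff)
    qed
    ultimately show ?thesis by blast
  qed
  then show ?thesis using \<theta> by blast
qed

text \<open>
  Two boundary points above a ball of the zero set both have \<open>c = 0\<close>, so the linear part
  \<open>h \<mapsto> h/2 - k cnj h\<close> nearly annihilates their difference.
\<close>

lemma k_near_half_aux:
  assumes w: "w \<in> W" "norm w < \<rho>/40" "0 \<le> Im (c w)"
    and n: "norm n < \<rho>/40" "0 < r" "ball n r \<subseteq> ball 0 \<rho> - W"
  shows "\<bar>1/2 - k\<bar> \<le> 5 * \<epsilon>"
proof -
  define s where "s = \<rho> / 40"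
  have s: "0 < s" using rho by (simp add: s_def)
  have ws: "norm w < s" and ns: "norm n < s" using w n by (auto simp: s_def)
  define x where "x = min (r/2) s"
  have x: "0 < x" "x < r" "x \<le> s" using n s by (auto simp: x_def)
  have bw: "\<bar>Re w\<bar> < s" "\<bar>Im w\<bar> < s" and bn: "\<bar>Re n\<bar> < s" "\<bar>Im n\<bar> < s"
    using ws ns abs_Re_le_cmod[of w] abs_Im_le_cmod[of w] abs_Re_le_cmod[of n] abs_Im_le_cmod[of n]
    by linarith+
  have wP: "w + \<i> * of_real s \<in> P"
  proof (rule upward(1)[OF w(1,3) s])
    show "w + \<i> * of_real s \<in> ball 0 \<rho>"
      using norm_triangle_ineq[of w "\<i> * of_real s"] ws s by (simp add: norm_mult s_def)
  qed
  have top: "\<exists>t. m + \<i> * of_real t \<notin> W \<and> m + \<i> * of_real t \<in> closure P \<and> norm (m + \<i> * of_real t) < \<rho>/5"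
    if m: "m \<in> ball n r" "norm m < 2 * s" "Im m = Im n" "\<bar>Re m - Re n\<bar> \<le> s" for m
  proof -
    let ?h = "m + \<i> * of_real (6 * s) - (w + \<i> * of_real s)"
    have nb: "norm (m + \<i> * of_real t) < \<rho>/5" if "0 \<le> t" "t \<le> 6 * s" for t
      using norm_triangle_ineq[of m "\<i> * of_real t"] that m by (simp add: norm_mult s_def)
    have "(w + \<i> * of_real s) + ?h \<in> P"
    proof (rule cone_step(1)[OF wP])
      show "\<bar>Re ?h\<bar> \<le> Im ?h" using m bw bn by simp
      show "(w + \<i> * of_real s) + ?h \<in> ball 0 \<rho>" using nb[of "6 * s"] s rho by (simp add: ac_simps)
    qed
    then have mP: "m + \<i> * of_real (6 * s) \<in> P" by (simp only: add_diff_cancel_left' diff_add_cancel add.commute[of "w + _"])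
    have "m \<notin> W" "m \<in> ball 0 \<rho>" "0 < 6 * s" using m n s by auto
    then obtain t where t: "0 \<le> t" "t < 6 * s" "m + \<i> * of_real t \<notin> W" "m + \<i> * of_real t \<in> closure P"
      by (rule top_point[OF _ _ _ mP]) blast
    then show ?thesis using nb[of t] by auto
  qed
  obtain t1 where t1: "n + \<i> * of_real t1 \<notin> W" "n + \<i> * of_real t1 \<in> closure P" "norm (n + \<i> * of_real t1) < \<rho>/5"
    using top[of n] n ns s by auto
  have "norm (n + of_real x) < 2 * s"
    using norm_triangle_ineq[of n "of_real x"] ns x by simp
  then obtain t2 where t2: "n + of_real x + \<i> * of_real t2 \<notin> W" "n + of_real x + \<i> * of_real t2 \<in> closure P"
      "norm (n + of_real x + \<i> * of_real t2) < \<rho>/5"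
    using top[of "n + of_real x"] x by (auto simp: dist_norm)
  define z1 where "z1 = n + \<i> * of_real t1"
  define z2 where "z2 = n + of_real x + \<i> * of_real t2"
  have c0: "c z1 = 0" "c z2 = 0" using zero t1 t2 rho by (auto simp: z1_def z2_def)
  have ne: "z1 \<noteq> z2" using x by (auto simp: z1_def z2_def complex_eq_iff)
  define h where "h = z1 - z2"
  have "norm ((c z1 - z1 / 2 + k * cnj z1) - (c z2 - z2 / 2 + k * cnj z2)) \<le> 5 * \<epsilon> * norm (z1 - z2)"
    by (rule c_affine_on_closure_P) (use t1 t2 in \<open>simp_all add: z1_def z2_def\<close>)
  moreover have "(c z1 - z1 / 2 + k * cnj z1) - (c z2 - z2 / 2 + k * cnj z2) = - (h / 2 - k * cnj h)"
    by (simp add: c0 h_def algebra_simps diff_divide_distrib)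
  ultimately have le: "norm (h / 2 - k * cnj h) \<le> 5 * \<epsilon> * norm h"
    by (simp only: norm_minus_cancel h_def)
  have "\<bar>1/2 - k\<bar> * norm h \<le> norm (h / 2 - k * cnj h)"
  proof -
    have "(h / 2 - k * cnj h) = Complex ((1/2 - k) * Re h) ((1/2 + k) * Im h)"
      by (simp add: complex_eq_iff algebra_simps)
    then have "(norm (h / 2 - k * cnj h))\<^sup>2 = ((1/2 - k) * Re h)\<^sup>2 + ((1/2 + k) * Im h)\<^sup>2"
      by (simp add: cmod_power2)
    moreover have "(1/2 - k)\<^sup>2 \<le> (1/2 + k)\<^sup>2" using k0 by (intro power2_le_iff_abs_le[THEN iffD2]) auto
    then have "((1/2 - k) * Im h)\<^sup>2 \<le> ((1/2 + k) * Im h)\<^sup>2"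
      by (simp add: power_mult_distrib mult_right_mono)
    moreover have "(\<bar>1/2 - k\<bar> * norm h)\<^sup>2 = ((1/2 - k) * Re h)\<^sup>2 + ((1/2 - k) * Im h)\<^sup>2"
      by (simp add: power_mult_distrib cmod_power2 distrib_left)
    ultimately have "(\<bar>1/2 - k\<bar> * norm h)\<^sup>2 \<le> (norm (h / 2 - k * cnj h))\<^sup>2" by linarith
    then show ?thesis by (rule power2_le_imp_le) simp
  qed
  with le have "\<bar>1/2 - k\<bar> * norm h \<le> 5 * \<epsilon> * norm h" by linarith
  moreover have "0 < norm h" using ne by (simp add: h_def)
  ultimately show ?thesis by simp
qed

lemma k_near_half:
  assumes W0: "0 \<in> closure W" and N0: "0 \<in> closure (interior (ball 0 \<rho> - W))"
  shows "\<bar>1/2 - k\<bar> \<le> 5 * \<epsilon>"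
proof -
  have "0 < \<rho>/40" using rho by simp
  with W0 N0 obtain w n where w: "w \<in> W" "norm w < \<rho>/40"
    and n: "n \<in> interior (ball 0 \<rho> - W)" "norm n < \<rho>/40"
    unfolding closure_approachable by (metis dist_norm diff_zero)
  from n(1) obtain r where r: "0 < r" "ball n r \<subseteq> ball 0 \<rho> - W"
    by (auto simp: mem_interior)
  show ?thesis
  proof (cases "0 \<le> Im (c w)")
    case True
    with k_near_half_aux w n r show ?thesis by blast
  next
    case False
    interpret F: hodograph "cnj ` W" "\<lambda>z. cnj (c (cnj z))" "\<lambda>z. cnj (\<kappa> (cnj z))" \<rho> k \<epsilon> L
      by (rule flip)
    show ?thesis
    proof (rule F.k_near_half_aux[of "cnj w" "cnj n" r])
      show "ball (cnj n) r \<subseteq> ball 0 \<rho> - cnj ` W"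
      proof
        fix z assume "z \<in> ball (cnj n) r"
        then have "cnj z \<in> ball n r" using dist_cnj[of n "cnj z"] by simp
        then have "cnj z \<in> ball 0 \<rho> - W" using r by blast
        then show "z \<in> ball 0 \<rho> - cnj ` W" by (simp add: cnj_image_iff)
      qed
    qed (use False w n r in auto)
  qed
qed


subsection \<open>The hodograph transform and its inverse\<close>

definition Psi :: "complex \<Rightarrow> complex" where
  "Psi z = of_real (Re z) - cnj (c z)"

lemma Im_Psi [simp]: "Im (Psi z) = Im (c z)"
  by (simp add: Psi_def)

lemma Psi_not_W: "z \<in> ball 0 \<rho> \<Longrightarrow> z \<notin> W \<Longrightarrow> Psi z = of_real (Re z)"
  by (simp add: Psi_def zero)

lemma Psi_cont: "continuous_on (ball 0 \<rho>) Psi"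
  unfolding Psi_def by (intro continuous_intros c_cont)

lemma Psi_holomorphic: "Psi holomorphic_on W"
proof -
  have "(Psi has_field_derivative (1/2 - cnj (\<kappa> z))) (at z)" if "z \<in> W" for z
  proof -
    have "(Psi has_derivative (\<lambda>h. of_real (Re h) - cnj (h/2 + \<kappa> z * cnj h))) (at z)"
      unfolding Psi_def by (intro derivative_intros der[OF that])
    moreover have "(\<lambda>h. of_real (Re h) - cnj (h/2 + \<kappa> z * cnj h)) = (*) (1/2 - cnj (\<kappa> z))"
      by (simp add: fun_eq_iff complex_eq_iff algebra_simps)
    ultimately show ?thesis by (simp add: has_field_derivative_def)
  qed
  then show ?thesis
    using W_open by (auto simp: holomorphic_on_open)
qed

lemma W_axis_closure_P:
  assumes "z \<in> W" "0 \<le> Im (c z)"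
  shows "z \<in> closure P"
proof -
  have "\<exists>y\<in>P. dist y z < e" if "0 < e" for e
  proof -
    define t where "t = min e (\<rho> - norm z) / 2"
    have "norm z < \<rho>" using assms W_sub by auto
    then have t: "0 < t" "t < e" "t < \<rho> - norm z" using that by (auto simp: t_def)
    have "z + \<i> * of_real t \<in> P"
      using upward(1)[OF assms t(1)] t norm_triangle_ineq[of z "\<i> * of_real t"]
      by (simp add: norm_mult)
    moreover have "dist (z + \<i> * of_real t) z < e" using t by (simp add: dist_norm norm_mult)
    ultimately show ?thesis by blast
  qed
  then show ?thesis unfolding closure_approachable by blast
qed

lemma singleton_column_closure_P:
  assumes n: "n \<in> ball 0 \<rho>" "n \<notin> W"
    and sing: "\<And>q. q \<in> ball 0 \<rho> - W \<Longrightarrow> Re q = Re n \<Longrightarrow> q = n"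
  shows "n \<in> closure P"
proof -
  define s where "s = (\<rho> - norm n) / 2"
  have s: "0 < s" "norm n + s < \<rho>" using n by (auto simp: s_def field_simps)
  have b: "n + \<i> * of_real t \<in> ball 0 \<rho>" if "0 \<le> t" "t \<le> s" for t
    using norm_triangle_ineq[of n "\<i> * of_real t"] s that by (simp add: norm_mult)
  show ?thesis
  proof (rule free_above_P[OF n(2,1) s(1)])
    show "n + \<i> * of_real s \<in> ball 0 \<rho>" using b s by simp
    show "n + \<i> * of_real t \<in> W" if "0 < t" "t \<le> s" for t
      using sing[of "n + \<i> * of_real t"] b[of t] that by auto
  qed
qed

lemma top_above_interior:
  assumes P0: "0 \<in> closure P" and n: "norm n < \<rho>/40" and r: "0 < r" "ball n r \<subseteq> ball 0 \<rho> - W"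
  obtains t where "0 < t" "n + \<i> * of_real t \<notin> W" "n + \<i> * of_real t \<in> closure P"
    "norm (n + \<i> * of_real t) < \<rho> / 5"
proof -
  define s where "s = \<rho> / 10"
  have s: "0 < s" using rho by (simp add: s_def)
  have nb: "norm (n + \<i> * of_real t) < \<rho> / 5" if "0 \<le> t" "t \<le> s" for t
    using norm_triangle_ineq[of n "\<i> * of_real t"] n that by (simp add: norm_mult s_def)
  have nr: "\<bar>Re n\<bar> < \<rho>/40" "\<bar>Im n\<bar> < \<rho>/40"
    using abs_Re_le_cmod[of n] abs_Im_le_cmod[of n] n by linarith+
  have "0 + (n + \<i> * of_real s) \<in> P"
    by (rule closure_P_upward[OF P0]) (use nr nb[of s] s rho in \<open>auto simp: s_def\<close>)
  then have sP: "n + \<i> * of_real s \<in> P" by simp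
  have "n \<notin> W" "n \<in> ball 0 \<rho>" using r centre_in_ball[of n r] by blast+
  then obtain t where t: "0 \<le> t" "t < s" "n + \<i> * of_real t \<notin> W" "n + \<i> * of_real t \<in> closure P"
    "\<And>r. 0 \<le> r \<Longrightarrow> r \<le> s \<Longrightarrow> n + \<i> * of_real r \<notin> W \<Longrightarrow> r \<le> t"
    by (rule top_point[OF _ _ s sP]) blast
  define r' where "r' = min (r/2) s"
  have r': "0 < r'" "r' \<le> s" "r' < r" using r s by (auto simp: r'_def)
  have "n + \<i> * of_real r' \<in> ball n r" using r' by (simp add: dist_norm norm_mult)
  then have "n + \<i> * of_real r' \<notin> W" using r by blast
  then have "0 < t" using t(5)[of r'] r' by linarith
  with t nb[of t] show ?thesis by (intro that[of t]) auto
qed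

end

locale hodograph_half = hodograph +
  assumes k_half: "k = 1/2"
begin

lemma Psi_near_id:
  assumes z1: "z1 \<in> closure P" "norm z1 < \<rho> / 5" and z2: "z2 \<in> closure P" "norm z2 < \<rho> / 5"
  shows "norm ((Psi z1 - Psi z2) - (z1 - z2)) \<le> norm (z1 - z2) / 4"
proof -
  have "norm ((c z1 - z1 / 2 + k * cnj z1) - (c z2 - z2 / 2 + k * cnj z2)) \<le> 5 * \<epsilon> * norm (z1 - z2)"
    by (rule c_affine_on_closure_P[OF assms])
  moreover have "(Psi z1 - Psi z2) - (z1 - z2)
      = - cnj ((c z1 - z1 / 2 + k * cnj z1) - (c z2 - z2 / 2 + k * cnj z2))"
    by (simp add: Psi_def k_half complex_eq_iff field_simps)
  ultimately have "norm ((Psi z1 - Psi z2) - (z1 - z2)) \<le> 5 * \<epsilon> * norm (z1 - z2)"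
    by (simp only: norm_minus_cancel complex_mod_cnj)
  also have "\<dots> \<le> 1/4 * norm (z1 - z2)"
    using eps by (intro mult_right_mono) auto
  finally show ?thesis by simp
qed

lemma Psi_expand:
  assumes "z1 \<in> closure P" "norm z1 < \<rho> / 5" "z2 \<in> closure P" "norm z2 < \<rho> / 5"
  shows "norm (z1 - z2) \<le> 4/3 * norm (Psi z1 - Psi z2)"
proof -
  have "norm (z1 - z2) \<le> norm (Psi z1 - Psi z2) + norm ((Psi z1 - Psi z2) - (z1 - z2))"
    using norm_triangle_ineq4[of "Psi z1 - Psi z2" "(Psi z1 - Psi z2) - (z1 - z2)"] by simp
  with Psi_near_id[OF assms] show ?thesis by simp
qed

lemma Psi_inj:
  assumes "z1 \<in> closure P" "norm z1 < \<rho> / 5" "z2 \<in> closure P" "norm z2 < \<rho> / 5" "Psi z1 = Psi z2"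
  shows "z1 = z2"
  using Psi_expand[OF assms(1-4)] assms(5) by simp

lemma half_inverse:
  assumes 0: "0 \<notin> W" and P0: "0 \<in> closure P"
  shows "\<exists>G. G holomorphic_on (ball 0 (\<rho>/20) \<inter> {w. 0 < Im w}) \<and>
    continuous_on (ball 0 (\<rho>/20) \<inter> {w. 0 \<le> Im w}) G \<and>
    (\<forall>w. w \<in> ball 0 (\<rho>/20) \<longrightarrow> 0 \<le> Im w \<longrightarrow> G w \<in> closure P \<and> norm (G w) < \<rho>/5 \<and> Psi (G w) = w)"
proof -
  define r where "r = \<rho>/10"
  define D where "D = ball (0::complex) (\<rho>/20) \<inter> {w. 0 < Im w}"
  define D' where "D' = ball (0::complex) (\<rho>/20) \<inter> {w. 0 \<le> Im w}"
  define V where "V = P \<inter> ball 0 r"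
  define C where "C = Psi ` (closure P \<inter> cball 0 r)"
  have r5: "norm z < \<rho>/5" if "norm z \<le> r" for z :: complex using that rho by (simp add: r_def)
  have Psi0: "Psi 0 = 0" using Psi_not_W[of 0] 0 rho by simp
  have bound: "norm z < r" if "z \<in> closure P" "norm z \<le> r" "norm (Psi z) < \<rho>/20" for z
  proof -
    have "norm z \<le> 4/3 * norm (Psi z)"
      using Psi_expand[of z 0] that r5[of z] rho P0 Psi0 by simp
    then show ?thesis using that rho by (simp add: r_def)
  qed
  have V: "open V" "V \<subseteq> W" "V \<subseteq> closure P" using P_open P_sub closure_subset[of P] by (auto simp: V_def)
  have injV: "inj_on Psi V"
  proof (rule inj_onI)
    fix x y assume "x \<in> V" "y \<in> V" "Psi x = Psi y"
    then show "x = y" using Psi_inj[of x y] V(3) r5[of x] r5[of y] by (auto simp: subset_iff V_def)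
  qed
  have holV: "Psi holomorphic_on V" by (rule holomorphic_on_subset[OF Psi_holomorphic V(2)])
  have openV: "open (Psi ` V)" by (rule open_mapping_thm3[OF holV V(1) injV])
  have sub: "closure P \<inter> cball 0 r \<subseteq> ball 0 \<rho>" using rho by (auto simp: r_def)
  have "compact C" unfolding C_def
    by (intro compact_continuous_image continuous_on_subset[OF Psi_cont sub]) (auto intro: closed_Int_compact)
  then have clC: "closed C" by (rule compact_imp_closed)
  have eq: "D \<inter> Psi ` V = D \<inter> C"
  proof
    show "D \<inter> Psi ` V \<subseteq> D \<inter> C" using V(3) by (auto simp: C_def V_def)
    show "D \<inter> C \<subseteq> D \<inter> Psi ` V"
    proof
      fix w assume w: "w \<in> D \<inter> C"
      then obtain z where z: "z \<in> closure P" "norm z \<le> r" "w = Psi z" by (auto simp: C_def)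
      have "norm z < r" using bound z w by (auto simp: D_def)
      moreover have "z \<in> P" using w z r5[of z] rho by (auto simp: D_def P_def)
      ultimately show "w \<in> D \<inter> Psi ` V" using w z by (auto simp: V_def)
    qed
  qed
  have conn: "connected D" unfolding D_def
    by (intro convex_connected convex_Int convex_ball convex_halfspace_Im_gt)
  have "openin (top_of_set D) (D \<inter> Psi ` V)" by (rule openin_open_Int[OF openV])
  moreover have "closedin (top_of_set D) (D \<inter> Psi ` V)" unfolding eq by (rule closedin_closed_Int[OF clC])
  moreover have "D \<inter> Psi ` V \<noteq> {}"
  proof -
    have "0 < \<rho>/40" using rho by simp
    with P0 obtain z where z: "z \<in> P" "norm z < \<rho>/40"
      unfolding closure_approachable by (metis dist_norm diff_zero)
    have "norm (Psi z - z) \<le> norm z / 4"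
      using Psi_near_id[of z 0] z closure_subset[of P] P0 rho Psi0 by auto
    then have "norm (Psi z) \<le> norm z + norm z / 4"
      using norm_triangle_ineq[of z "Psi z - z"] by simp
    then have "norm (Psi z) < \<rho>/20" using z norm_ge_zero[of z] by linarith
    moreover have "0 < Im (Psi z)" using z by (simp add: P_def)
    ultimately have "Psi z \<in> D" by (simp add: D_def)
    moreover have "z \<in> V" using z rho by (simp add: V_def r_def)
    ultimately show ?thesis by blast
  qed
  ultimately have "D \<inter> Psi ` V = D" using conn unfolding connected_clopen by blast
  then have DV: "D \<subseteq> Psi ` V" by blast
  have "D' \<subseteq> closure D"
  proof
    fix w assume w: "w \<in> D'"
    have "\<exists>y\<in>D. dist y w < e" if "0 < e" for e
    proof -
      define t where "t = min e (\<rho>/20 - norm w) / 2"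
      have t: "0 < t" "t < e" "t < \<rho>/20 - norm w" using w that by (auto simp: t_def D'_def)
      have "w + \<i> * of_real t \<in> D"
        using w t norm_triangle_ineq[of w "\<i> * of_real t"] by (simp add: D_def D'_def norm_mult)
      moreover have "dist (w + \<i> * of_real t) w < e" using t by (simp add: dist_norm norm_mult)
      ultimately show ?thesis by blast
    qed
    then show "w \<in> closure D" unfolding closure_approachable by blast
  qed
  moreover have "D \<subseteq> C" using DV eq by blast
  then have "closure D \<subseteq> C" using clC by (rule closure_minimal)
  ultimately have D'C: "D' \<subseteq> C" by blast
  define G where "G w = (SOME z. z \<in> closure P \<and> norm z < r \<and> Psi z = w)" for w
  have G: "G w \<in> closure P \<and> norm (G w) < r \<and> Psi (G w) = w" if "w \<in> D'" for w
  proof -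
    from that D'C obtain z where z: "z \<in> closure P" "norm z \<le> r" "Psi z = w" by (auto simp: C_def)
    then have "z \<in> closure P \<and> norm z < r \<and> Psi z = w" using bound that by (auto simp: D'_def)
    then show ?thesis unfolding G_def by (rule someI)
  qed
  have G5: "G w \<in> closure P" "norm (G w) < \<rho>/5" "Psi (G w) = w" if "w \<in> D'" for w
    using G[OF that] r5[of "G w"] by auto
  have "(4/3)-lipschitz_on D' G"
  proof (rule lipschitz_onI)
    fix x y assume xy: "x \<in> D'" "y \<in> D'"
    show "dist (G x) (G y) \<le> 4/3 * dist x y"
      using Psi_expand[OF G5(1,2)[OF xy(1)] G5(1,2)[OF xy(2)]] G5(3) xy by (simp add: dist_norm)
  qed simp
  then have contG: "continuous_on D' G" by (rule lipschitz_on_continuous_on)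
  obtain g where g: "g holomorphic_on Psi ` V" "\<And>z. z \<in> V \<Longrightarrow> g (Psi z) = z"
    by (rule holomorphic_has_inverse[OF holV V(1) injV]) blast
  have "G w = g w" if w: "w \<in> D" for w
  proof -
    from w DV obtain z where z: "z \<in> V" "w = Psi z" by blast
    have wD': "w \<in> D'" using w by (auto simp: D_def D'_def)
    have "G w = z"
      by (rule Psi_inj) (use G5[OF wD'] z V(3) r5[of z] in \<open>auto simp: V_def\<close>)
    then show ?thesis using g(2) z by simp
  qed
  then have "G holomorphic_on D"
    by (rule holomorphic_transform[OF holomorphic_on_subset[OF g(1) DV], OF sym])
  then show ?thesis using contG G5 by (intro exI[of _ G]) (auto simp: D_def D'_def)
qed

lemma flip_half: "hodograph_half (cnj ` W) (\<lambda>z. cnj (c (cnj z))) (\<lambda>z. cnj (\<kappa> (cnj z))) \<rho> k \<epsilon> L"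
  by (intro hodograph_half.intro flip hodograph_half_axioms.intro k_half)

lemma singleton_columns_isolated:
  assumes 0: "0 \<notin> W" and N0: "0 \<in> closure (interior (ball 0 \<rho> - W))"
    and X: "X \<subseteq> ball 0 \<rho> - W" "0 islimpt X"
    and sing: "\<And>z q. z \<in> X \<Longrightarrow> q \<in> ball 0 \<rho> - W \<Longrightarrow> Re q = Re z \<Longrightarrow> q = z"
  shows False
proof -
  interpret F: hodograph_half "cnj ` W" "\<lambda>z. cnj (c (cnj z))" "\<lambda>z. cnj (\<kappa> (cnj z))" \<rho> k \<epsilon> L
    by (rule flip_half)
  have near: "\<exists>x\<in>X. x \<noteq> 0 \<and> norm x < e" if "0 < e" for e
    using X(2) that unfolding islimpt_approachable by auto
  have no_segment: False
    if z: "z \<in> ball 0 \<rho>" "z \<notin> W" "Re z = 0" and d: "0 < d" "z + \<i> * of_real d \<in> ball 0 \<rho>" "z + \<i> * of_real d \<notin> W" for z d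
  proof -
    define e where "e = min (d / (13 * L)) (min (\<rho> - norm z) (\<rho> - norm (z + \<i> * of_real d)))"
    have "0 < e" using z d L0 by (simp add: e_def)
    then obtain x where x: "x \<in> X" "norm x < e" using near by blast
    define h where "h = Re x"
    have h: "\<bar>h\<bar> < e" using abs_Re_le_cmod[of x] x by (simp add: h_def)
    then have "\<bar>h\<bar> < d / (13 * L)" by (simp add: e_def)
    then have Lh: "13 * (L * \<bar>h\<bar>) < d" using L0 by (simp add: field_simps)
    have b: "z + of_real h \<in> ball 0 \<rho>" "z + of_real h + \<i> * of_real d \<in> ball 0 \<rho>"
    proof -
      show "z + of_real h \<in> ball 0 \<rho>"
        using norm_triangle_ineq[of z "of_real h"] h by (simp add: e_def)
      have "norm ((z + \<i> * of_real d) + of_real h) < \<rho>"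
        using norm_triangle_ineq[of "z + \<i> * of_real d" "of_real h"] h by (simp add: e_def)
      then show "z + of_real h + \<i> * of_real d \<in> ball 0 \<rho>" by (simp add: ac_simps)
    qed
    have eq: "z + of_real h + \<i> * of_real (t * d) = x" if t: "1/3 \<le> t" "t \<le> 1/2" for t
    proof (rule sing[OF x(1)])
      have td: "d * (1/3) \<le> d * t" "d * t \<le> d * (1/2)" using d t by (intro mult_left_mono; simp)+
      have "z + of_real h + \<i> * of_real (t * d) \<notin> W"
      proof (rule not_W_between[OF z(1,2) d(2,3) b])
        have "0 \<le> L * \<bar>h\<bar>" using L0 by simp
        moreover have "4 * L * \<bar>h\<bar> = 4 * (L * \<bar>h\<bar>)" "t * d = d * t" by simp_all
        ultimately show "4 * L * \<bar>h\<bar> < t * d" "t * d < d - 4 * L * \<bar>h\<bar>" using Lh td d by linarith+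
      qed
      moreover have "z + of_real h + of_real t * (\<i> * of_real d) \<in> ball 0 \<rho>"
        by (rule segment_in_ball[OF b]) (use t in auto)
      ultimately show "z + of_real h + \<i> * of_real (t * d) \<in> ball 0 \<rho> - W" by (simp add: ac_simps)
      show "Re (z + of_real h + \<i> * of_real (t * d)) = Re x" using z by (simp add: h_def)
    qed
    from eq[of "1/3"] eq[of "1/2"] d show False by (simp add: complex_eq_iff)
  qed
  have z0: "0 \<in> ball 0 \<rho>" using rho by simp
  have sing0: "q = 0" if q: "q \<in> ball 0 \<rho> - W" "Re q = 0" for q
  proof (rule ccontr)
    assume "q \<noteq> 0"
    then consider "0 < Im q" | "Im q < 0" using q by (fastforce simp: complex_eq_iff)
    then show False
    proof cases
      case 1
      have e: "0 + \<i> * of_real (Im q) = q" using q by (simp add: complex_eq_iff)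
      show False using no_segment[of 0 "Im q"] 1 q 0 z0 unfolding e by auto
    next
      case 2
      have e: "q + \<i> * of_real (- Im q) = 0" using q by (simp add: complex_eq_iff)
      show False using no_segment[of q "- Im q"] 2 q 0 z0 unfolding e by auto
    qed
  qed
  have clP: "x \<in> closure P" "cnj x \<in> closure F.P" if x: "x = 0 \<or> x \<in> X" for x
  proof -
    have xs: "x \<in> ball 0 \<rho>" "x \<notin> W" "\<And>q. q \<in> ball 0 \<rho> - W \<Longrightarrow> Re q = Re x \<Longrightarrow> q = x"
      using x X(1) 0 z0 sing[of x] sing0 by auto
    show "x \<in> closure P" by (rule singleton_column_closure_P[OF xs])
    show "cnj x \<in> closure F.P"
    proof (rule F.singleton_column_closure_P)
      fix q assume "q \<in> ball 0 \<rho> - cnj ` W" "Re q = Re (cnj x)"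
      then have "cnj q = x" by (intro xs(3)) (auto simp: cnj_image_iff)
      then show "q = cnj x" by auto
    qed (use xs in \<open>auto simp: cnj_image_iff\<close>)
  qed
  have P0: "0 \<in> closure P" "0 \<in> closure F.P" using clP[of 0] by auto
  obtain G where G: "G holomorphic_on (ball 0 (\<rho>/20) \<inter> {w. 0 < Im w})"
    "continuous_on (ball 0 (\<rho>/20) \<inter> {w. 0 \<le> Im w}) G"
    "\<And>w. w \<in> ball 0 (\<rho>/20) \<Longrightarrow> 0 \<le> Im w \<Longrightarrow> G w \<in> closure P \<and> norm (G w) < \<rho>/5 \<and> Psi (G w) = w"
    using half_inverse[OF 0 P0(1)] by blast
  have "0 \<notin> cnj ` W" using 0 by (simp add: cnj_image_iff)
  from F.half_inverse[OF this P0(2)] obtain G' where G': "G' holomorphic_on (ball 0 (\<rho>/20) \<inter> {w. 0 < Im w})"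
    "continuous_on (ball 0 (\<rho>/20) \<inter> {w. 0 \<le> Im w}) G'"
    "\<And>w. w \<in> ball 0 (\<rho>/20) \<Longrightarrow> 0 \<le> Im w \<Longrightarrow> G' w \<in> closure F.P \<and> norm (G' w) < \<rho>/5 \<and> F.Psi (G' w) = w"
    by blast
  have Gt: "G t = z" if "Psi z = t" "z \<in> closure P" "norm z < \<rho>/5" "t \<in> ball 0 (\<rho>/20)" "0 \<le> Im t" for z t
    using Psi_inj[of "G t" z] G(3)[of t] that by auto
  have G't: "G' t = z" if "F.Psi z = t" "z \<in> closure F.P" "norm z < \<rho>/5" "t \<in> ball 0 (\<rho>/20)" "0 \<le> Im t" for z t
    using F.Psi_inj[of "G' t" z] G'(3)[of t] that by auto
  have FPsi: "F.Psi z = cnj (Psi (cnj z))" for z by (simp add: F.Psi_def Psi_def)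
  define D where "D w = G w + G' w - 2 * w" for w
  define f where "f w = (D w)\<^sup>2" for w
  have real: "f t \<in> \<real>" if t: "t \<in> ball 0 (\<rho>/20)" "t \<in> \<real>" for t
  proof -
    have It: "Im t = 0" using t by (simp add: complex_is_Real_iff)
    have g: "G t \<in> closure P" "norm (G t) < \<rho>/5" "Psi (G t) = t" using G(3)[OF t(1)] It by auto
    have g': "G' t \<in> closure F.P" "norm (G' t) < \<rho>/5" "F.Psi (G' t) = t" using G'(3)[OF t(1)] It by auto
    have cnj_t: "cnj t = t" using It by (simp add: complex_eq_iff)
    have Ic: "Im (c (G t)) = 0" using It g(3) Im_Psi by metis
    have Ic': "Im (c (cnj (G' t))) = 0" using It g'(3) F.Im_Psi[of "G' t"] by simp
    have "D t \<in> \<real> \<or> Re (D t) = 0"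
    proof -
      consider "G t \<in> W" | "cnj (G' t) \<in> W" | "G t \<notin> W" "cnj (G' t) \<notin> W" by blast
      then show ?thesis
      proof cases
        case 1
        have "cnj (G t) \<in> closure F.P"
          by (rule F.W_axis_closure_P) (use 1 Ic in \<open>auto simp: cnj_image_iff\<close>)
        then have "G' t = cnj (G t)"
          by (intro G't) (use g t It cnj_t in \<open>auto simp: FPsi\<close>)
        then show ?thesis by (simp add: D_def complex_is_Real_iff It)
      next
        case 2
        have "cnj (G' t) \<in> closure P"
          by (rule W_axis_closure_P) (use 2 Ic' in auto)
        moreover have "Psi (cnj (G' t)) = t" using g'(3) cnj_t FPsi by (metis complex_cnj_cnj)
        ultimately have "G t = cnj (G' t)"
          by (intro Gt) (use g' t It in auto)
        then show ?thesis by (simp add: D_def complex_is_Real_iff It)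
      next
        case 3
        have "t = of_real (Re (G t))"
          using Psi_not_W[of "G t"] g 3 rho by auto
        then have "Re (G t) = Re t" by (metis Re_complex_of_real)
        moreover have "t = of_real (Re (G' t))"
          using F.Psi_not_W[of "G' t"] g' 3 rho by (auto simp: cnj_image_iff)
        then have "Re (G' t) = Re t" by (metis Re_complex_of_real)
        ultimately show ?thesis by (simp add: D_def)
      qed
    qed
    then show ?thesis
      by (auto simp: f_def complex_is_Real_iff power2_eq_square)
  qed
  define R where "R z = (if 0 \<le> Im z then f z else cnj (f (cnj z)))" for z
  have holR: "R holomorphic_on ball 0 (\<rho>/20)"
    unfolding R_def
  proof (rule Schwarz_reflection)
    show "f holomorphic_on ball 0 (\<rho>/20) \<inter> {z. 0 < Im z}"
      unfolding f_def D_def by (intro holomorphic_intros G G')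
    show "continuous_on (ball 0 (\<rho>/20) \<inter> {z. 0 \<le> Im z}) f"
      unfolding f_def D_def by (intro continuous_intros G G')
  qed (use real in auto)
  define U where "U = (\<lambda>x. of_real (Re x) :: complex) ` (X \<inter> ball 0 (\<rho>/20))"
  have "R w = 0" if w: "w \<in> ball 0 (\<rho>/20)" for w
  proof (rule analytic_continuation[OF holR open_ball connected_ball _ _ _ _ w])
    show "U \<subseteq> ball 0 (\<rho>/20)"
    proof
      fix w assume "w \<in> U"
      then obtain x where "norm x < \<rho>/20" "w = of_real (Re x)" by (auto simp: U_def)
      then show "w \<in> ball 0 (\<rho>/20)" using abs_Re_le_cmod[of x] by simp
    qed
    show "(0::complex) \<in> ball 0 (\<rho>/20)" using rho by simp
    show "0 islimpt U"
      unfolding islimpt_approachable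
    proof (intro allI impI)
      fix e :: real assume "0 < e"
      then have "0 < min e (\<rho>/20)" using rho by simp
      then obtain x where x: "x \<in> X" "x \<noteq> 0" "norm x < min e (\<rho>/20)" using near by blast
      have "Re x \<noteq> 0" using sing[OF x(1), of 0] x(2) 0 z0 by auto
      moreover have "norm (of_real (Re x) :: complex) < e" using x abs_Re_le_cmod[of x] by simp
      ultimately show "\<exists>x'\<in>U. x' \<noteq> 0 \<and> dist x' 0 < e" using x by (auto simp: U_def)
    qed
    show "R z = 0" if "z \<in> U" for z
    proof -
      from that obtain x where x: "x \<in> X" "norm x < \<rho>/20" "z = of_real (Re x)" by (auto simp: U_def)
      have xb: "x \<notin> W" "x \<in> ball 0 \<rho>" using x X by auto
      have zb: "z \<in> ball 0 (\<rho>/20)" using x abs_Re_le_cmod[of x] by simp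
      have "G z = x"
        by (rule Gt) (use xb x zb clP[of x] rho Psi_not_W[of x] in auto)
      moreover have "G' z = cnj x"
        by (rule G't) (use xb x zb clP[of x] rho Psi_not_W[of x] in \<open>auto simp: FPsi\<close>)
      ultimately have "D z = x + cnj x - 2 * z" by (simp add: D_def)
      moreover have "x + cnj x - 2 * z = 0" using x(3) by (simp add: complex_eq_iff)
      ultimately have "D z = 0" by simp
      then show ?thesis using x by (simp add: R_def f_def)
    qed
  qed
  have "0 < \<rho>/40" using rho by simp
  with N0 obtain n where n: "n \<in> interior (ball 0 \<rho> - W)" "norm n < \<rho>/40"
    unfolding closure_approachable by (metis dist_norm diff_zero)
  from n(1) obtain r where r: "0 < r" "ball n r \<subseteq> ball 0 \<rho> - W"
    by (auto simp: mem_interior)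
  have r': "ball (cnj n) r \<subseteq> ball 0 \<rho> - cnj ` W"
  proof
    fix z assume "z \<in> ball (cnj n) r"
    then have "cnj z \<in> ball n r" using dist_cnj[of n "cnj z"] by simp
    then have "cnj z \<in> ball 0 \<rho> - W" using r by blast
    then show "z \<in> ball 0 \<rho> - cnj ` W" by (simp add: cnj_image_iff)
  qed
  obtain a where a: "0 < a" "n + \<i> * of_real a \<notin> W" "n + \<i> * of_real a \<in> closure P" "norm (n + \<i> * of_real a) < \<rho> / 5"
    by (rule top_above_interior[OF P0(1) n(2) r])
  obtain b where b: "0 < b" "cnj n + \<i> * of_real b \<notin> cnj ` W" "cnj n + \<i> * of_real b \<in> closure F.P"
    "norm (cnj n + \<i> * of_real b) < \<rho> / 5"
    by (rule F.top_above_interior[OF P0(2) _ r(1) r']) (use n(2) in simp)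
  define t where "t = complex_of_real (Re n)"
  have tb: "t \<in> ball 0 (\<rho>/20)" "Im t = 0" using abs_Re_le_cmod[of n] n rho by (auto simp: t_def)
  have "G t = n + \<i> * of_real a"
    by (rule Gt) (use a tb rho Psi_not_W[of "n + \<i> * of_real a"] in \<open>auto simp: t_def\<close>)
  moreover have "G' t = cnj n + \<i> * of_real b"
    by (rule G't) (use b tb rho F.Psi_not_W[of "cnj n + \<i> * of_real b"] in \<open>auto simp: t_def\<close>)
  ultimately have "D t = n + \<i> * of_real a + (cnj n + \<i> * of_real b) - 2 * t"
    by (simp add: D_def)
  also have "\<dots> = \<i> * of_real (a + b)" by (simp add: t_def complex_eq_iff)
  finally have "D t = \<i> * of_real (a + b)" .
  moreover have "R t = 0" using \<open>\<And>w. w \<in> ball 0 (\<rho>/20) \<Longrightarrow> R w = 0\<close> tb by blast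
  then have "D t = 0" using tb by (simp add: R_def f_def)
  ultimately show False using a b by (simp add: complex_eq_iff)
qed

end

subsection \<open>The obstacle problem in complex coordinates\<close>

definition vec_of :: "complex \<Rightarrow> real^2" where
  "vec_of z = vector [Re z, Im z]"

definition cplx_of :: "real^2 \<Rightarrow> complex" where
  "cplx_of x = Complex (x $ 1) (x $ 2)"

lemma vec_of_nth [simp]: "vec_of z $ 1 = Re z" "vec_of z $ 2 = Im z"
  by (simp_all add: vec_of_def)

lemma cplx_of_sel [simp]: "Re (cplx_of x) = x $ 1" "Im (cplx_of x) = x $ 2"
  by (simp_all add: cplx_of_def)

lemma vec_of_cplx_of [simp]: "vec_of (cplx_of x) = x"
  by (simp add: vec_eq_iff forall_2)

lemma cplx_of_vec_of [simp]: "cplx_of (vec_of z) = z"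
  by (simp add: complex_eq_iff)

lemma norm_cplx_of [simp]: "norm (cplx_of x) = norm x"
  by (simp add: cmod_def norm_vec_def L2_set_def sum_2)

lemma bounded_linear_cplx_of: "bounded_linear cplx_of"
  by (rule bounded_linear_intro[where K = 1]) (auto simp: complex_eq_iff)

lemma norm_vec_of [simp]: "norm (vec_of z) = norm z"
  by (metis cplx_of_vec_of norm_cplx_of)

lemma bounded_linear_vec_of: "bounded_linear vec_of"
  by (rule bounded_linear_intro[where K = 1]) (auto simp: vec_eq_iff forall_2)

locale obstacle =
  fixes u :: "real^2 \<Rightarrow> real" and g :: "real^2 \<Rightarrow> real^2" and H H' :: "real^2 \<Rightarrow> real^2^2" and L :: real
  assumes nonneg: "\<And>x. x \<in> B1 \<Longrightarrow> 0 \<le> u x"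
    and grad: "\<And>x. x \<in> B1 \<Longrightarrow> (u has_derivative (\<lambda>h. g x \<bullet> h)) (at x)"
    and L_pos: "0 < L"
    and g_lip: "\<And>x y. x \<in> B1 \<Longrightarrow> y \<in> B1 \<Longrightarrow> norm (g x - g y) \<le> L * dist x y"
    and hess: "\<And>x. x \<in> pos_set u \<Longrightarrow> (g has_derivative (\<lambda>h. H x *v h)) (at x)"
    and H'_cont: "continuous_on (closure (pos_set u) \<inter> B1) H'"
    and H'_eq: "\<And>x. x \<in> pos_set u \<Longrightarrow> H' x = H x"
    and lap: "\<And>x. x \<in> pos_set u \<Longrightarrow> H x $ 1 $ 1 + H x $ 2 $ 2 = 1"
begin

lemma pos_set_sub: "pos_set u \<subseteq> B1"
  by (auto simp: pos_set_def)

lemma open_B1: "open B1"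
  by (simp add: B1_def)

lemma open_pos_set: "open (pos_set u)"
proof -
  have "continuous_on B1 u"
    using grad by (meson continuous_at_imp_continuous_on has_derivative_continuous)
  then have "open (B1 \<inter> u -` {0<..})"
    by (intro continuous_open_preimage open_B1) auto
  then show ?thesis by (simp add: pos_set_def vimage_def Int_def)
qed

lemma grad_zero:
  assumes "x \<in> B1" "x \<notin> pos_set u"
  shows "g x = 0"
proof -
  have "u x = 0" using assms nonneg[of x] by (auto simp: pos_set_def)
  then have "(\<lambda>h. g x \<bullet> h) = (\<lambda>h. 0)"
    using nonneg by (intro differential_zero_maxmin[OF assms(1) open_B1 grad[OF assms(1)]]) auto
  then have "g x \<bullet> g x = 0" by meson
  then show ?thesis by simp
qed

lemma hess_symmetric:
  assumes "x \<in> pos_set u"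
  shows "H x $ 1 $ 2 = H x $ 2 $ 1"
proof -
  have "axis 1 1 \<bullet> (H x *v axis 2 1) = axis 2 1 \<bullet> (H x *v axis 1 1)"
    by (rule second_derivative_symmetric[OF open_pos_set assms grad hess[OF assms]])
      (use pos_set_sub in auto)
  then show ?thesis
    by (simp add: inner_axis' matrix_vector_mult_basis column_def)
qed

definition anti :: "real^2^2 \<Rightarrow> complex" where
  "anti A = Complex (A $ 1 $ 1 - 1/2) (A $ 1 $ 2)"

lemma cplx_hess:
  assumes "x \<in> pos_set u"
  shows "cplx_of (H x *v vec_of v) = v / 2 + anti (H x) * cnj v"
proof -
  have "H x $ 2 $ 2 = 1 - H x $ 1 $ 1" "H x $ 2 $ 1 = H x $ 1 $ 2"
    using lap[OF assms] hess_symmetric[OF assms] by simp_all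
  then show ?thesis
    by (auto simp only: complex_eq_iff cplx_of_sel matrix_vector_mult_def sum_2 vec_lambda_beta vec_of_nth)
      (simp_all add: anti_def algebra_simps)
qed

definition chart :: "real^2 \<Rightarrow> complex \<Rightarrow> complex \<Rightarrow> real^2" where
  "chart x0 \<omega> z = x0 + vec_of (\<omega> * z)"

definition chart_W :: "real^2 \<Rightarrow> complex \<Rightarrow> real \<Rightarrow> complex set" where
  "chart_W x0 \<omega> \<rho> = {z \<in> ball 0 \<rho>. chart x0 \<omega> z \<in> pos_set u}"

definition chart_c :: "real^2 \<Rightarrow> complex \<Rightarrow> complex \<Rightarrow> complex" where
  "chart_c x0 \<omega> z = cnj \<omega> * cplx_of (g (chart x0 \<omega> z))"

definition chart_\<kappa> :: "real^2 \<Rightarrow> complex \<Rightarrow> complex \<Rightarrow> complex" where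
  "chart_\<kappa> x0 \<omega> z = anti (H (chart x0 \<omega> z)) * (cnj \<omega>)\<^sup>2"

lemma dist_chart:
  assumes "norm \<omega> = 1"
  shows "dist (chart x0 \<omega> z) (chart x0 \<omega> w) = dist z w"
proof -
  have "chart x0 \<omega> z - chart x0 \<omega> w = vec_of (\<omega> * (z - w))"
    by (simp add: chart_def right_diff_distrib linear_diff[OF bounded_linear.linear[OF bounded_linear_vec_of]])
  then show ?thesis using assms by (simp add: dist_norm norm_mult)
qed

lemma chart_0 [simp]: "chart x0 \<omega> 0 = x0"
  by (simp add: chart_def vec_eq_iff forall_2)

lemma chart_surj:
  assumes "norm \<omega> = 1"
  obtains z where "chart x0 \<omega> z = x"
proof -
  have "\<omega> * (cnj \<omega> * cplx_of (x - x0)) = cplx_of (x - x0)"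
    using assms complex_norm_square[of \<omega>] by (simp flip: mult.assoc)
  then have "chart x0 \<omega> (cnj \<omega> * cplx_of (x - x0)) = x" by (simp only: chart_def vec_of_cplx_of) simp
  then show ?thesis by (rule that)
qed

lemma chart_hodograph:
  assumes \<omega>: "norm \<omega> = 1" and x0: "x0 \<in> closure (pos_set u)" "x0 \<in> B1"
    and rot: "anti (H' x0) * (cnj \<omega>)\<^sup>2 = - of_real (norm (anti (H' x0)))"
    and \<epsilon>: "0 < \<epsilon>" "\<epsilon> \<le> 1/20"
  obtains \<rho> where "0 < \<rho>" "ball x0 \<rho> \<subseteq> B1"
    "hodograph (chart_W x0 \<omega> \<rho>) (chart_c x0 \<omega>) (chart_\<kappa> x0 \<omega>) \<rho> (norm (anti (H' x0))) \<epsilon> L"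
proof -
  have "continuous_on (closure (pos_set u) \<inter> B1) (\<lambda>x. anti (H' x))"
    unfolding anti_def complex_eq_iff Complex_eq
    by (intro continuous_intros H'_cont)
  then obtain d where d: "0 < d" "\<And>x. x \<in> closure (pos_set u) \<inter> B1 \<Longrightarrow> dist x x0 < d \<Longrightarrow> dist (anti (H' x)) (anti (H' x0)) < \<epsilon>"
    using x0 \<epsilon>(1) unfolding continuous_on_iff by (metis IntI)
  obtain d' where d': "0 < d'" "ball x0 d' \<subseteq> B1" using open_B1 x0(2) openE by blast
  define \<rho> where "\<rho> = min d d'"
  have \<rho>: "0 < \<rho>" "ball x0 \<rho> \<subseteq> B1" using d d' by (auto simp: \<rho>_def)
  have ch: "dist (chart x0 \<omega> z) x0 = norm z" for z
    using dist_chart[OF \<omega>, of x0 z 0] by simp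
  have inB: "chart x0 \<omega> z \<in> B1" if "z \<in> ball 0 \<rho>" for z
    using \<rho>(2) that ch[of z] by (auto simp: dist_commute subset_iff)
  have cd: "(chart x0 \<omega> has_derivative (\<lambda>h. vec_of (\<omega> * h))) (at z)" for z
    unfolding chart_def
    by (auto intro!: derivative_eq_intros bounded_linear.has_derivative[OF bounded_linear_vec_of])
  have \<omega>1: "cnj \<omega> * \<omega> = 1" using \<omega> complex_norm_square[of \<omega>] by (simp add: mult.commute)
  have "hodograph (chart_W x0 \<omega> \<rho>) (chart_c x0 \<omega>) (chart_\<kappa> x0 \<omega>) \<rho> (norm (anti (H' x0))) \<epsilon> L"
  proof
    show "open (chart_W x0 \<omega> \<rho>)"
    proof -
      have "continuous_on UNIV (chart x0 \<omega>)"
        using cd by (meson continuous_at_imp_continuous_on has_derivative_continuous)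
      then have "open (ball 0 \<rho> \<inter> chart x0 \<omega> -` pos_set u)"
        by (intro open_Int open_vimage open_pos_set) auto
      then show ?thesis by (simp add: chart_W_def vimage_def Int_def)
    qed
    show "norm (chart_c x0 \<omega> z - chart_c x0 \<omega> w) \<le> L * dist z w"
      if "z \<in> ball 0 \<rho>" "w \<in> ball 0 \<rho>" for z w
    proof -
      have "chart_c x0 \<omega> z - chart_c x0 \<omega> w = cnj \<omega> * cplx_of (g (chart x0 \<omega> z) - g (chart x0 \<omega> w))"
        by (simp add: chart_c_def right_diff_distrib linear_diff[OF bounded_linear.linear[OF bounded_linear_cplx_of]])
      then show ?thesis
        using g_lip[OF inB[OF that(1)] inB[OF that(2)]] \<omega> dist_chart[OF \<omega>, of x0 z w] by (simp add: norm_mult)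
    qed
    show "chart_c x0 \<omega> z = 0" if "z \<in> ball 0 \<rho>" "z \<notin> chart_W x0 \<omega> \<rho>" for z
      using grad_zero[OF inB[OF that(1)]] that by (auto simp: chart_c_def chart_W_def complex_eq_iff)
    show "(chart_c x0 \<omega> has_derivative (\<lambda>h. h / 2 + chart_\<kappa> x0 \<omega> z * cnj h)) (at z)"
      if "z \<in> chart_W x0 \<omega> \<rho>" for z
    proof -
      let ?x = "chart x0 \<omega> z"
      have x: "?x \<in> pos_set u" using that by (simp add: chart_W_def)
      have gd: "((\<lambda>z. g (chart x0 \<omega> z)) has_derivative (\<lambda>h. H ?x *v vec_of (\<omega> * h))) (at z)"
        by (rule has_derivative_compose[OF cd hess[OF x]])
      have "((\<lambda>z. cnj \<omega> * cplx_of (g (chart x0 \<omega> z))) has_derivative (\<lambda>h. cnj \<omega> * cplx_of (H ?x *v vec_of (\<omega> * h)))) (at z)"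
        by (intro has_derivative_mult_right bounded_linear.has_derivative[OF bounded_linear_cplx_of] gd)
      moreover have "cnj \<omega> * cplx_of (H ?x *v vec_of (\<omega> * h)) = h / 2 + chart_\<kappa> x0 \<omega> z * cnj h" for h
      proof -
        have "cnj \<omega> * cplx_of (H ?x *v vec_of (\<omega> * h)) = (cnj \<omega> * \<omega>) * h / 2 + anti (H ?x) * (cnj \<omega>)\<^sup>2 * cnj h"
          unfolding cplx_hess[OF x] by (simp add: algebra_simps power2_eq_square)
        then show ?thesis by (simp add: \<omega>1 chart_\<kappa>_def)
      qed
      ultimately show ?thesis by (simp add: chart_c_def[abs_def])
    qed
    show "norm (chart_\<kappa> x0 \<omega> z + of_real (norm (anti (H' x0)))) \<le> \<epsilon>" if z: "z \<in> chart_W x0 \<omega> \<rho>" for z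
    proof -
      let ?x = "chart x0 \<omega> z"
      have x: "?x \<in> pos_set u" and zb: "z \<in> ball 0 \<rho>" using z by (auto simp: chart_W_def)
      have "chart_\<kappa> x0 \<omega> z + of_real (norm (anti (H' x0))) = (anti (H' ?x) - anti (H' x0)) * (cnj \<omega>)\<^sup>2"
        using rot by (simp add: chart_\<kappa>_def H'_eq[OF x] left_diff_distrib)
      moreover have "dist (anti (H' ?x)) (anti (H' x0)) < \<epsilon>"
        using d(2)[of ?x] x pos_set_sub closure_subset[of "pos_set u"] zb ch[of z] by (auto simp: \<rho>_def)
      ultimately show ?thesis using \<omega> by (simp add: norm_mult norm_power dist_norm)
    qed
  qed (use \<rho> \<epsilon> L_pos in \<open>auto simp: chart_W_def\<close>)
  with \<rho> show ?thesis by (rule that)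
qed

lemma rotation_exists: "\<exists>\<omega>. norm \<omega> = 1 \<and> a * (cnj \<omega>)\<^sup>2 = - of_real (norm a)" for a :: complex
proof (cases "a = 0")
  case False
  define \<omega> where "\<omega> = csqrt (- a / norm a)"
  have sq: "\<omega>\<^sup>2 = - a / norm a" by (simp add: \<omega>_def)
  then have "(norm \<omega>)\<^sup>2 = 1" using False by (simp add: norm_divide flip: norm_power)
  then have "norm \<omega> = 1" by (simp add: power2_eq_1_iff) (metis norm_ge_zero neg_0_le_iff_le not_one_le_zero)
  moreover have "a * (cnj \<omega>)\<^sup>2 = - of_real (norm a)"
  proof -
    have "(cnj \<omega>)\<^sup>2 = - cnj a / norm a" by (simp add: sq flip: complex_cnj_power)
    then have "a * (cnj \<omega>)\<^sup>2 = - (a * cnj a) / norm a" by simp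
    also have "a * cnj a = of_real ((norm a)\<^sup>2)" using complex_norm_square[of a] by simp
    finally show ?thesis using False by (simp add: power2_eq_square)
  qed
  ultimately show ?thesis by blast
qed (auto intro: exI[of _ 1])

lemma no_limit_of_branching_points:
  assumes x0: "x0 \<in> B1" and lim: "x0 islimpt branching_points u"
  shows False
proof -
  have br: "branching_points u \<subseteq> frontier (pos_set u)" "branching_points u \<subseteq> closure (interior {y \<in> B1. u y = 0})"
    by (auto simp: branching_points_def)
  have xf: "x0 \<in> frontier (pos_set u)"
    using islimpt_subset[OF lim br(1)] frontier_closed closed_limpt by blast
  then have xc: "x0 \<in> closure (pos_set u)" and xn: "x0 \<notin> pos_set u"
    using open_pos_set by (auto simp: frontier_def interior_open)
  have xi: "x0 \<in> closure (interior {y \<in> B1. u y = 0})"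
    using islimpt_subset[OF lim br(2)] closed_closure closed_limpt by blast
  obtain \<omega> where \<omega>: "norm \<omega> = 1" "anti (H' x0) * (cnj \<omega>)\<^sup>2 = - of_real (norm (anti (H' x0)))"
    using rotation_exists by blast
  let ?k = "norm (anti (H' x0))"
  have ch: "dist (chart x0 \<omega> z) x0 = norm z" for z
    using dist_chart[OF \<omega>(1), of x0 z 0] by simp
  have chart_near: "\<exists>z. z \<in> ball 0 \<rho> \<and> norm z < e \<and> chart x0 \<omega> z \<in> S"
    if "x0 \<in> closure S" "0 < \<rho>" "0 < e" for S \<rho> e
  proof -
    have "0 < min e \<rho>" using that by simp
    with that(1) obtain y where y: "y \<in> S" "dist y x0 < min e \<rho>"
      unfolding closure_approachable by blast
    obtain z where "chart x0 \<omega> z = y" by (rule chart_surj[OF \<omega>(1)])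
    then show ?thesis using y ch[of z] by (intro exI[of _ z]) auto
  qed
  have W0: "0 \<in> closure (chart_W x0 \<omega> \<rho>)" if "0 < \<rho>" for \<rho>
    unfolding closure_approachable
  proof (intro allI impI)
    fix e :: real assume "0 < e"
    from chart_near[OF xc that this] show "\<exists>y\<in>chart_W x0 \<omega> \<rho>. dist y 0 < e"
      by (auto simp: chart_W_def)
  qed
  have N0: "0 \<in> closure (interior (ball 0 \<rho> - chart_W x0 \<omega> \<rho>))" if "0 < \<rho>" for \<rho>
    unfolding closure_approachable
  proof (intro allI impI)
    fix e :: real assume "0 < e"
    from chart_near[OF xi that this] obtain z where z: "z \<in> ball 0 \<rho>" "norm z < e"
      "chart x0 \<omega> z \<in> interior {y \<in> B1. u y = 0}" by blast
    from z(3) obtain r where r: "0 < r" "ball (chart x0 \<omega> z) r \<subseteq> {y \<in> B1. u y = 0}"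
      by (auto simp: mem_interior)
    have "ball z (min r (\<rho> - norm z)) \<subseteq> ball 0 \<rho> - chart_W x0 \<omega> \<rho>"
    proof
      fix w assume w: "w \<in> ball z (min r (\<rho> - norm z))"
      then have "chart x0 \<omega> w \<in> ball (chart x0 \<omega> z) r" by (simp add: dist_chart[OF \<omega>(1)])
      then have "u (chart x0 \<omega> w) = 0" using r by blast
      moreover have "norm w < \<rho>" using w norm_triangle_sub[of w z] by (simp add: dist_norm norm_minus_commute)
      ultimately show "w \<in> ball 0 \<rho> - chart_W x0 \<omega> \<rho>" by (simp add: chart_W_def pos_set_def)
    qed
    moreover have "0 < min r (\<rho> - norm z)" using r z by simp
    ultimately have "z \<in> interior (ball 0 \<rho> - chart_W x0 \<omega> \<rho>)" unfolding mem_interior by blast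
    then show "\<exists>y\<in>interior (ball 0 \<rho> - chart_W x0 \<omega> \<rho>). dist y 0 < e" using z by auto
  qed
  have k: "?k = 1/2"
  proof (rule ccontr)
    assume ne: "?k \<noteq> 1/2"
    define \<epsilon> where "\<epsilon> = min (1/20) (\<bar>1/2 - ?k\<bar> / 10)"
    have \<epsilon>: "0 < \<epsilon>" "\<epsilon> \<le> 1/20" "\<epsilon> \<le> \<bar>1/2 - ?k\<bar> / 10" using ne unfolding \<epsilon>_def by (simp, simp, intro min.cobounded2)
    obtain \<rho> where \<rho>: "0 < \<rho>" "ball x0 \<rho> \<subseteq> B1"
      "hodograph (chart_W x0 \<omega> \<rho>) (chart_c x0 \<omega>) (chart_\<kappa> x0 \<omega>) \<rho> ?k \<epsilon> L"
      by (rule chart_hodograph[OF \<omega>(1) xc x0 \<omega>(2) \<epsilon>(1,2)])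
    have "\<bar>1/2 - ?k\<bar> \<le> 5 * \<epsilon>" by (rule hodograph.k_near_half[OF \<rho>(3) W0[OF \<rho>(1)] N0[OF \<rho>(1)]])
    moreover have "\<epsilon> * 10 \<le> \<bar>1/2 - ?k\<bar>" using \<epsilon>(3) by (simp add: le_divide_eq)
    ultimately show False using \<epsilon>(1) by linarith
  qed
  obtain \<rho> where \<rho>: "0 < \<rho>" "ball x0 \<rho> \<subseteq> B1"
    "hodograph (chart_W x0 \<omega> \<rho>) (chart_c x0 \<omega>) (chart_\<kappa> x0 \<omega>) \<rho> ?k (1/20) L"
    by (rule chart_hodograph[OF \<omega>(1) xc x0 \<omega>(2), of "1/20"]) auto
  interpret hodograph_half "chart_W x0 \<omega> \<rho>" "chart_c x0 \<omega>" "chart_\<kappa> x0 \<omega>" \<rho> ?k "1/20" L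
    by (intro hodograph_half.intro \<rho>(3) hodograph_half_axioms.intro k)
  define X where "X = {z \<in> ball 0 \<rho>. chart x0 \<omega> z \<in> branching_points u}"
  show False
  proof (rule singleton_columns_isolated[of X])
    show "0 \<notin> chart_W x0 \<omega> \<rho>" using xn by (simp add: chart_W_def)
    show "0 \<in> closure (interior (ball 0 \<rho> - chart_W x0 \<omega> \<rho>))" by (rule N0[OF \<rho>(1)])
    have "branching_points u \<inter> pos_set u = {}"
      using br(1) open_pos_set by (auto simp: frontier_def interior_open)
    then show XW: "X \<subseteq> ball 0 \<rho> - chart_W x0 \<omega> \<rho>" by (auto simp: X_def chart_W_def)
    show "0 islimpt X"
      unfolding islimpt_approachable
    proof (intro allI impI)
      fix e :: real assume "0 < e"
      then have "0 < min e \<rho>" using \<rho> by simp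
      then obtain y where y: "y \<in> branching_points u" "y \<noteq> x0" "dist y x0 < min e \<rho>"
        using lim unfolding islimpt_approachable by blast
      obtain z where z: "chart x0 \<omega> z = y" by (rule chart_surj[OF \<omega>(1)])
      have "z \<noteq> 0" using z y by auto
      then show "\<exists>x'\<in>X. x' \<noteq> 0 \<and> dist x' 0 < e"
        using y z ch[of z] by (intro bexI[of _ z]) (auto simp: X_def)
    qed
    show "q = z" if z: "z \<in> X" and q: "q \<in> ball 0 \<rho> - chart_W x0 \<omega> \<rho>" and Re: "Re q = Re z" for z q
    proof (rule ccontr)
      assume "q \<noteq> z"
      then obtain \<theta> r0 where \<theta>: "0 < \<theta>" "\<theta> < 1/2" "0 < r0"
        and hole: "\<And>r. 0 < r \<Longrightarrow> r < r0 \<Longrightarrow> \<exists>y. dist y z \<le> r/2 \<and> ball y (\<theta> * r) \<subseteq> ball 0 \<rho> - chart_W x0 \<omega> \<rho>"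
        using complement_fat_of_column[of z q] z q Re XW by blast
      have "\<exists>y. dist y (chart x0 \<omega> z) \<le> r/2 \<and> ball y (\<theta> * r) \<inter> pos_set u = {}" if r: "0 < r" "r < r0" for r
      proof -
        obtain y where y: "dist y z \<le> r/2" "ball y (\<theta> * r) \<subseteq> ball 0 \<rho> - chart_W x0 \<omega> \<rho>"
          using hole[OF r] by blast
        have "x \<notin> pos_set u" if x: "x \<in> ball (chart x0 \<omega> y) (\<theta> * r)" for x
        proof -
          obtain w where w: "chart x0 \<omega> w = x" by (rule chart_surj[OF \<omega>(1)])
          have "w \<in> ball y (\<theta> * r)" using x by (simp add: dist_chart[OF \<omega>(1)] flip: w)
          then have "w \<in> ball 0 \<rho> - chart_W x0 \<omega> \<rho>" using y by blast
          then show ?thesis using w by (simp add: chart_W_def)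
        qed
        moreover have "dist (chart x0 \<omega> y) (chart x0 \<omega> z) \<le> r/2" using y by (simp add: dist_chart[OF \<omega>(1)])
        ultimately show ?thesis by blast
      qed
      from not_density_one[OF open_pos_set \<theta> this] z show False
        by (simp add: X_def branching_points_def)
    qed
  qed
qed

end

theorem theorem1p3:
  fixes u :: "real^2 \<Rightarrow> real"
    and g :: "real^2 \<Rightarrow> real^2"
    and H :: "real^2 \<Rightarrow> real^2^2"
  assumes nonneg: "\<forall>x\<in>B1. u x \<ge> 0"
    and grad: "\<forall>x\<in>B1. (u has_derivative (\<lambda>h. g x \<bullet> h)) (at x)"
    and C11: "\<exists>L. \<forall>x\<in>B1. \<forall>y\<in>B1. norm (g x - g y) \<le> L * dist x y"
    and hess: "\<forall>x\<in>pos_set u. (g has_derivative (\<lambda>h. H x *v h)) (at x)"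
    and C2: "\<exists>H'. continuous_on (closure (pos_set u) \<inter> B1) H' \<and>
                  (\<forall>x\<in>pos_set u. H' x = H x)"
    and lap: "\<forall>x\<in>pos_set u. H x $ 1 $ 1 + H x $ 2 $ 2 = 1"
    and bdry: "\<forall>x\<in>frontier (pos_set u) \<inter> B1. u x = 0 \<and> g x = 0"
  shows "\<forall>K. compact K \<and> K \<subseteq> B1 \<longrightarrow> finite (K \<inter> branching_points u)"
proof (intro allI impI)
  fix K assume K: "compact K \<and> K \<subseteq> B1"
  obtain L where L: "\<And>x y. x \<in> B1 \<Longrightarrow> y \<in> B1 \<Longrightarrow> norm (g x - g y) \<le> L * dist x y"
    using C11 by blast
  obtain H' where H': "continuous_on (closure (pos_set u) \<inter> B1) H'" "\<And>x. x \<in> pos_set u \<Longrightarrow> H' x = H x"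
    using C2 by blast
  interpret obstacle u g H H' "max L 1"
  proof
    fix x y assume "x \<in> B1" "y \<in> B1"
    then have "norm (g x - g y) \<le> L * dist x y" by (rule L)
    also have "\<dots> \<le> max L 1 * dist x y" by (intro mult_right_mono) auto
    finally show "norm (g x - g y) \<le> max L 1 * dist x y" .
  qed (use nonneg grad hess H' lap in auto)
  show "finite (K \<inter> branching_points u)"
  proof (rule ccontr)
    assume "infinite (K \<inter> branching_points u)"
    then obtain x where "x \<in> K" "x islimpt (K \<inter> branching_points u)"
      using Heine_Borel_imp_Bolzano_Weierstrass[of K] K by blast
    then have "x \<in> B1" "x islimpt branching_points u" using K islimpt_subset by blast+
    then show False by (rule no_limit_of_branching_points)
  qed
qed

end
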